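(* There exists an absolute constant $L$ such that for all $n\in\mathbb{N}$, all $d>0$ and all block subspaces $Z\prec Y\prec T$: if $Z\prec Y$ is $n$-stable at $d$, then $$(Kn)^{-1}\le d\le Ln^{-1}.$$
   Context: For finite sets $E,F\subseteq\mathbb{N}$ write $E<F$ (resp. $E\le F$) if $\max E<\min F$ (resp. $\max E\le\min F$) or if either set is empty. The Schreier classes are $S_0=\{\{n\}:n\in\mathbb{N}\}\cup\{\emptyset\}$ and $S_{k+1}=\{\bigcup_{p=1}^{\ell}E_p:\{\ell\}\le E_1<\cdots<E_\ell,\ E_p\in S_k \text{ for } 1\le p\le\ell\}$. A family of finite nonempty sets $(E_i)_{i=1}^\ell$ is $k$-admissible if $E_1<\cdots<E_\ell$ and $\{\min E_i\}_{i=1}^\ell\in S_k$. $c_{00}$ is the space of finitely supported real sequences, with unit vector basis $(e_i)$; for $x=\sum_i x(i)e_i$ put $Ex=\sum_{i\in E}x(i)e_i$. Tsirelson's space $T=T(S_1,2^{-1})$ is the completion of $c_{00}$ under the norm given implicitly by $\|x\|=\|x\|_\infty\vee\sup\{\frac12\sum_{i=1}^\ell\|E_ix\|:(E_i)_1^\ell \text{ is 1-admissible}\}$. An admissible tree is a finite tree of finite subsets of $\mathbb{N}$ (ordered by reverse inclusion), with a single set of level $0$, such that the successors (which have level one greater) of any set in the tree, if there are any, form a 1-admissible partition of that set, and every set of level $m+1$ is a successor of some set of level $m$. A set of the tree is terminal if it has no successors. For integers $j\ge0$, $n\ge1$ and $x\in T$, $$|x|_j^n=\sup\Big\{\sum_{i\in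 A}2^{-(j+nk(i))}\|E_ix\|_\infty\Big\},$$ the supremum being over all admissible trees all of whose terminal sets have levels in $\{j,j+n,j+2n,\ldots\}$, where $(E_i)_{i\in A}$ are the terminal sets of the tree and $E_i$ has level $j+nk(i)$, $k(i)\ge0$. Each $|\cdot|_j^n$ is an equivalent norm on $T$. $Y\prec T$ means that $Y$ is the closed linear span of an (infinite) block basis $(y_i)$ of $(e_i)$, and $Z\prec Y$ means that $Z$ is the closed linear span of an infinite block basis of $(y_i)$. $S_Z=\{z\in Z:\|z\|=1\}$ (Tsirelson norm). $K>1$ denotes a fixed absolute constant with the property (such a $K$ exists) that for all $Y\prec T$ and $n\in\mathbb{N}$ there exist $Z\prec Y$ and $d>0$ with $d\le|z|_j^n\le Kd$ for all $0\le j<n$ and $z\in S_Z$. A block subspace $Z$ is called $n$-stable at $d$ if $$d=\inf_{0\le j<n}\inf_{z\in S_Z}|z|_j^n\le\sup_{0\le j<n}\sup_{z\in S_Z}|z|_j^n\le Kd .$$ *)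

theory Defs
  imports "HOL-Analysis.Analysis"
begin

section \<open>Schreier classes and admissible families\<close>

text \<open>
  Subsets of \<open>\<nat> = {1, 2, \<dots>}\<close> are sets of type \<^typ>\<open>nat set\<close> that do not contain \<open>0\<close>.
\<close>

definition set_less :: "nat set \<Rightarrow> nat set \<Rightarrow> bool" where
  "set_less E F \<longleftrightarrow> E = {} \<or> F = {} \<or> Max E < Min F"

definition set_le :: "nat set \<Rightarrow> nat set \<Rightarrow> bool" where
  "set_le E F \<longleftrightarrow> E = {} \<or> F = {} \<or> Max E \<le> Min F"

text \<open>
  The chain \<open>{l} \<le> E\<^sub>1 < \<dots> < E\<^sub>l\<close> is read pairwise.  For nonempty sets this is the same as the
  relations between neighbours, but an empty set in the chain would break the latter reading:
  with \<open>E\<^sub>1 = {}\<close> every finite set would be in the first class.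
\<close>

primrec schreier :: "nat \<Rightarrow> nat set set" where
  "schreier 0 = {{n} | n. 1 \<le> n} \<union> {{}}"
| "schreier (Suc k) =
     {(\<Union>p\<in>{1..l}. E p) | l E. 1 \<le> l \<and>
        (\<forall>p\<in>{1..l}. E p \<in> schreier k \<and> set_le {l} (E p)) \<and>
        (\<forall>p\<in>{1..l}. \<forall>q\<in>{1..l}. p < q \<longrightarrow> set_less (E p) (E q))}"

definition admissible :: "nat \<Rightarrow> nat set list \<Rightarrow> bool" where
  "admissible k Es \<longleftrightarrow>
     (\<forall>E\<in>set Es. finite E \<and> E \<noteq> {} \<and> 0 \<notin> E) \<and> sorted_wrt set_less Es \<and>
     Min ` set Es \<in> schreier k"


section \<open>The Tsirelson norm on finitely supported sequences\<close>

definition c00 :: "(nat \<Rightarrow> real) set" where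
  "c00 = {x. x 0 = 0 \<and> finite {i. x i \<noteq> 0}}"

definition restr :: "nat set \<Rightarrow> (nat \<Rightarrow> real) \<Rightarrow> nat \<Rightarrow> real" where
  "restr E x = (\<lambda>i. if i \<in> E then x i else 0)"

definition sup_norm :: "(nat \<Rightarrow> real) \<Rightarrow> real" where
  "sup_norm x = (SUP i. \<bar>x i\<bar>)"

definition norm_on_c00 :: "((nat \<Rightarrow> real) \<Rightarrow> real) \<Rightarrow> bool" where
  "norm_on_c00 N \<longleftrightarrow>
     (\<forall>x\<in>c00. 0 \<le> N x \<and> (N x = 0 \<longleftrightarrow> x = (\<lambda>_. 0))) \<and>
     (\<forall>c. \<forall>x\<in>c00. N (\<lambda>i. c * x i) = \<bar>c\<bar> * N x) \<and>
     (\<forall>x\<in>c00. \<forall>y\<in>c00. N (\<lambda>i. x i + y i) \<le> N x + N y)"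

definition half_sums :: "((nat \<Rightarrow> real) \<Rightarrow> real) \<Rightarrow> (nat \<Rightarrow> real) \<Rightarrow> real set" where
  "half_sums N x = {1/2 * (\<Sum>E\<leftarrow>Es. N (restr E x)) | Es. admissible 1 Es}"

definition tsirelson_equation :: "((nat \<Rightarrow> real) \<Rightarrow> real) \<Rightarrow> bool" where
  "tsirelson_equation N \<longleftrightarrow>
     (\<forall>x\<in>c00. bdd_above (half_sums N x) \<and> N x = max (sup_norm x) (Sup (half_sums N x)))"

text \<open>
  The value \<open>0\<close> off \<^const>\<open>c00\<close> is a convention that makes the function unique; see
  \<open>ex1_tsirelson_norm\<close> below for existence and uniqueness.
\<close>

definition tsirelson_norm :: "(nat \<Rightarrow> real) \<Rightarrow> real" where
  "tsirelson_norm =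
     (THE N. norm_on_c00 N \<and> tsirelson_equation N \<and> (\<forall>x. x \<notin> c00 \<longrightarrow> N x = 0))"


subsection \<open>Existence and uniqueness\<close>

lemma set_lessD: "set_less E F \<Longrightarrow> finite E \<Longrightarrow> finite F \<Longrightarrow> E \<inter> F = {}"
  unfolding set_less_def
  by (metis Int_emptyI Max_ge Min_le empty_iff le_less_trans less_le_trans less_irrefl)

lemma admissible_disjoint:
  assumes "admissible k Es"
  shows "sorted_wrt (\<lambda>E F. E \<inter> F = {}) Es"
proof -
  have "sorted_wrt set_less Es" "\<forall>E\<in>set Es. finite E"
    using assms by (auto simp: admissible_def)
  then show ?thesis
    by (induction Es) (auto dest!: set_lessD)
qed

lemma schreier_empty: "{} \<in> schreier k"
proof (induction k)
  case (Suc k)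
  show ?case
    apply (simp add: set_le_def set_less_def)
    apply (rule exI[of _ 1], rule exI[of _ "\<lambda>_. {}"])
    using Suc by auto
qed auto

lemma schreier_singleton: "1 \<le> n \<Longrightarrow> {n} \<in> schreier k"
proof (induction k)
  case (Suc k)
  then show ?case
    apply (simp add: set_le_def set_less_def)
    apply (rule exI[of _ 1], rule exI[of _ "\<lambda>_. {n}"])
    by auto
qed auto

lemma admissible_Nil: "admissible k []"
  by (simp add: admissible_def schreier_empty)

lemma admissible_single: "finite E \<Longrightarrow> E \<noteq> {} \<Longrightarrow> 0 \<notin> E \<Longrightarrow> admissible k [E]"
proof -
  assume E: "finite E" "E \<noteq> {}" "0 \<notin> E"
  then have "Min E \<noteq> 0" by (metis Min_in)
  then have "{Min E} \<in> schreier k" by (intro schreier_singleton) linarith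
  then show ?thesis using E by (simp add: admissible_def)
qed

lemma c00_zero [simp]: "(\<lambda>_. 0) \<in> c00"
  by (simp add: c00_def)

lemma c00_add: "x \<in> c00 \<Longrightarrow> y \<in> c00 \<Longrightarrow> (\<lambda>i. x i + y i) \<in> c00"
  by (auto simp: c00_def intro: finite_subset[of _ "{i. x i \<noteq> 0} \<union> {i. y i \<noteq> 0}"])

lemma c00_scale: "x \<in> c00 \<Longrightarrow> (\<lambda>i. c * x i) \<in> c00"
  by (auto simp: c00_def intro: finite_subset[of _ "{i. x i \<noteq> 0}"])

lemma c00_restr: "x \<in> c00 \<Longrightarrow> restr E x \<in> c00"
  by (auto simp: c00_def restr_def intro: finite_subset[of _ "{i. x i \<noteq> 0}"])

lemma c00_restr_finite: "x 0 = 0 \<Longrightarrow> finite E \<Longrightarrow> restr E x \<in> c00"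
  by (auto simp: c00_def restr_def intro: finite_subset[of _ E])

lemma restr_restr: "restr E (restr F x) = restr (E \<inter> F) x"
  by (auto simp: restr_def)

lemma restr_add: "restr E (\<lambda>i. x i + y i) = (\<lambda>i. restr E x i + restr E y i)"
  by (auto simp: restr_def)

lemma restr_scale: "restr E (\<lambda>i. c * x i) = (\<lambda>i. c * restr E x i)"
  by (auto simp: restr_def)

lemma restr_diff: "restr E (\<lambda>i. x i - y i) = (\<lambda>i. restr E x i - restr E y i)"
  by (auto simp: restr_def)

lemma restr_supp: "{i. x i \<noteq> 0} \<subseteq> E \<Longrightarrow> restr E x = x"
  by (fastforce simp: restr_def)

definition l1 :: "(nat \<Rightarrow> real) \<Rightarrow> real" where
  "l1 x = (\<Sum>i | x i \<noteq> 0. \<bar>x i\<bar>)"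

lemma l1_eq: "finite S \<Longrightarrow> {i. x i \<noteq> 0} \<subseteq> S \<Longrightarrow> l1 x = (\<Sum>i\<in>S. \<bar>x i\<bar>)"
  unfolding l1_def by (rule sum.mono_neutral_left) auto

lemma l1_nonneg: "0 \<le> l1 x"
  by (simp add: l1_def sum_nonneg)

lemma l1_restr_Un:
  assumes "x \<in> c00" "A \<inter> B = {}"
  shows "l1 (restr (A \<union> B) x) = l1 (restr A x) + l1 (restr B x)"
proof -
  let ?S = "{i. x i \<noteq> 0}"
  have f: "finite ?S" using assms by (simp add: c00_def)
  have e: "l1 (restr E x) = (\<Sum>i\<in>?S. \<bar>restr E x i\<bar>)" for E
    by (rule l1_eq[OF f]) (auto simp: restr_def)
  show ?thesis
    unfolding e sum.distrib[symmetric]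
    by (rule sum.cong) (use assms(2) in \<open>auto simp: restr_def\<close>)
qed

lemma l1_restr_le: 
  assumes "x \<in> c00" shows "l1 (restr A x) \<le> l1 x"
proof -
  have "l1 (restr (A \<union> -A) x) = l1 (restr A x) + l1 (restr (-A) x)"
    by (rule l1_restr_Un) (use assms in auto)
  then show ?thesis using l1_nonneg[of "restr (-A) x"] by (simp add: restr_def)
qed

lemma l1_restr_sum_list:
  assumes "x \<in> c00" "sorted_wrt (\<lambda>E F. E \<inter> F = {}) Es"
  shows "(\<Sum>E\<leftarrow>Es. l1 (restr E x)) = l1 (restr (\<Union>(set Es)) x)"
  using assms(2)
proof (induction Es)
  case Nil
  then show ?case by (simp add: restr_def l1_def)
next
  case (Cons E Es)
  have "l1 (restr (E \<union> \<Union>(set Es)) x) = l1 (restr E x) + l1 (restr (\<Union>(set Es)) x)"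
    by (rule l1_restr_Un[OF assms(1)]) (use Cons.prems in auto)
  then show ?case using Cons by simp
qed

lemma abs_le_l1:
  assumes "x \<in> c00" shows "\<bar>x i\<bar> \<le> l1 x"
proof -
  have f: "finite {i. x i \<noteq> 0}" using assms by (simp add: c00_def)
  show "\<bar>x i\<bar> \<le> l1 x"
  proof (cases "x i = 0")
    case False
    then show ?thesis unfolding l1_def by (intro member_le_sum) (use f in auto)
  qed (simp add: l1_nonneg)
qed

lemma c00_bdd: "x \<in> c00 \<Longrightarrow> bdd_above (range (\<lambda>i. \<bar>x i\<bar>))"
  by (rule bdd_aboveI2) (rule abs_le_l1)

lemma abs_le_sup_norm: "x \<in> c00 \<Longrightarrow> \<bar>x i\<bar> \<le> sup_norm x"
  unfolding sup_norm_def by (rule cSUP_upper) (auto intro: c00_bdd)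

lemma sup_norm_leI: "(\<And>i. \<bar>x i\<bar> \<le> c) \<Longrightarrow> sup_norm x \<le> c"
  unfolding sup_norm_def by (rule cSUP_least) auto

lemma sup_norm_nonneg: "x \<in> c00 \<Longrightarrow> 0 \<le> sup_norm x"
  using abs_le_sup_norm[of x 0] by linarith

lemma sup_norm_le_l1: "x \<in> c00 \<Longrightarrow> sup_norm x \<le> l1 x"
  by (rule sup_norm_leI) (rule abs_le_l1)

lemma sup_norm_add: "x \<in> c00 \<Longrightarrow> y \<in> c00 \<Longrightarrow> sup_norm (\<lambda>i. x i + y i) \<le> sup_norm x + sup_norm y"
  by (rule sup_norm_leI) (meson abs_triangle_ineq abs_le_sup_norm add_mono order_trans)

lemma sup_norm_restr: "x \<in> c00 \<Longrightarrow> sup_norm (restr E x) \<le> sup_norm x"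
  by (rule sup_norm_leI) (auto simp: restr_def abs_le_sup_norm sup_norm_nonneg)

lemma half_sums_nonempty: "half_sums N x \<noteq> {}"
  unfolding half_sums_def using admissible_Nil by blast

lemma half_sums_Sup_le:
  assumes "\<And>Es. admissible 1 Es \<Longrightarrow> 1/2 * (\<Sum>E\<leftarrow>Es. N (restr E x)) \<le> c"
  shows "Sup (half_sums N x) \<le> c"
proof (rule cSup_least[OF half_sums_nonempty])
  fix y assume "y \<in> half_sums N x"
  then show "y \<le> c" unfolding half_sums_def using assms by blast
qed

lemma half_sums_Sup_ge:
  assumes "bdd_above (half_sums N x)" "admissible 1 Es"
  shows "1/2 * (\<Sum>E\<leftarrow>Es. N (restr E x)) \<le> Sup (half_sums N x)"
  by (rule cSup_upper[OF _ assms(1)]) (use assms(2) in \<open>auto simp: half_sums_def\<close>)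

lemma half_sum_le_l1:
  assumes "x \<in> c00" "\<And>y. y \<in> c00 \<Longrightarrow> N y \<le> l1 y" "admissible 1 Es"
  shows "1/2 * (\<Sum>E\<leftarrow>Es. N (restr E x)) \<le> l1 x"
proof -
  have "(\<Sum>E\<leftarrow>Es. N (restr E x)) \<le> (\<Sum>E\<leftarrow>Es. l1 (restr E x))"
    by (rule sum_list_mono) (use assms c00_restr in auto)
  also have "\<dots> \<le> l1 x"
    using l1_restr_sum_list[OF assms(1) admissible_disjoint[OF assms(3)]]
      l1_restr_le[OF assms(1)] by simp
  finally show ?thesis using l1_nonneg[of x] by linarith
qed

lemma half_sums_bdd:
  assumes "x \<in> c00" "\<And>y. y \<in> c00 \<Longrightarrow> N y \<le> l1 y"
  shows "bdd_above (half_sums N x)"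
proof (rule bdd_aboveI[of _ "l1 x"])
  fix y assume "y \<in> half_sums N x"
  then show "y \<le> l1 x" unfolding half_sums_def using half_sum_le_l1[OF assms] by blast
qed

text \<open>The usual approximations of the norm by iteration.\<close>

primrec norm_iter :: "nat \<Rightarrow> (nat \<Rightarrow> real) \<Rightarrow> real" where
  "norm_iter 0 x = sup_norm x"
| "norm_iter (Suc m) x = max (sup_norm x) (Sup (half_sums (norm_iter m) x))"

lemma norm_iter_le_l1: "x \<in> c00 \<Longrightarrow> norm_iter m x \<le> l1 x"
proof (induction m arbitrary: x)
  case (Suc m)
  have "Sup (half_sums (norm_iter m) x) \<le> l1 x"
    by (rule half_sums_Sup_le, rule half_sum_le_l1) (use Suc in auto)
  then show ?case using sup_norm_le_l1[OF Suc.prems] by simp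
qed (simp add: sup_norm_le_l1)

lemma norm_iter_bdd: "x \<in> c00 \<Longrightarrow> bdd_above (half_sums (norm_iter m) x)"
  by (rule half_sums_bdd) (auto intro: norm_iter_le_l1)

lemma norm_iter_ge_sup: "sup_norm x \<le> norm_iter m x"
  by (cases m) auto

lemma norm_iter_nonneg: "x \<in> c00 \<Longrightarrow> 0 \<le> norm_iter m x"
  using norm_iter_ge_sup sup_norm_nonneg order_trans by blast

lemma norm_iter_ge_half:
  "x \<in> c00 \<Longrightarrow> admissible 1 Es \<Longrightarrow> 1/2 * (\<Sum>E\<leftarrow>Es. norm_iter m (restr E x)) \<le> norm_iter (Suc m) x"
  using half_sums_Sup_ge[OF norm_iter_bdd, of x Es m] by simp

lemma norm_iter_leI:
  assumes "sup_norm x \<le> c"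
    "\<And>Es m'. m = Suc m' \<Longrightarrow> admissible 1 Es \<Longrightarrow> 1/2 * (\<Sum>E\<leftarrow>Es. norm_iter m' (restr E x)) \<le> c"
  shows "norm_iter m x \<le> c"
  using assms half_sums_Sup_le[of "norm_iter (m - 1)" x c] by (cases m) auto

lemma norm_iter_mono: "x \<in> c00 \<Longrightarrow> norm_iter m x \<le> norm_iter (Suc m) x"
proof (induction m arbitrary: x)
  case (Suc m)
  show ?case
  proof (rule norm_iter_leI)
    fix Es m' assume m: "Suc m = Suc m'" and a: "admissible 1 Es"
    have "(\<Sum>E\<leftarrow>Es. norm_iter m (restr E x)) \<le> (\<Sum>E\<leftarrow>Es. norm_iter (Suc m) (restr E x))"
      by (rule sum_list_mono) (use Suc c00_restr in auto)
    then show "1/2 * (\<Sum>E\<leftarrow>Es. norm_iter m' (restr E x)) \<le> norm_iter (Suc (Suc m)) x"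
      using norm_iter_ge_half[OF Suc.prems a, of "Suc m"] m by simp
  qed (rule norm_iter_ge_sup)
qed simp

lemma norm_iter_add:
  "x \<in> c00 \<Longrightarrow> y \<in> c00 \<Longrightarrow> norm_iter m (\<lambda>i. x i + y i) \<le> norm_iter m x + norm_iter m y"
proof (induction m arbitrary: x y)
  case (Suc m)
  show ?case
  proof (rule norm_iter_leI)
    show "sup_norm (\<lambda>i. x i + y i) \<le> norm_iter (Suc m) x + norm_iter (Suc m) y"
      using sup_norm_add[OF Suc.prems] norm_iter_ge_sup[of x "Suc m"] norm_iter_ge_sup[of y "Suc m"]
      by linarith
    fix Es m' assume m: "Suc m = Suc m'" and a: "admissible 1 Es"
    have "(\<Sum>E\<leftarrow>Es. norm_iter m (restr E (\<lambda>i. x i + y i)))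
        \<le> (\<Sum>E\<leftarrow>Es. norm_iter m (restr E x) + norm_iter m (restr E y))"
      by (rule sum_list_mono) (use Suc c00_restr in \<open>auto simp: restr_add\<close>)
    then show "1/2 * (\<Sum>E\<leftarrow>Es. norm_iter m' (restr E (\<lambda>i. x i + y i)))
        \<le> norm_iter (Suc m) x + norm_iter (Suc m) y"
      using norm_iter_ge_half[OF Suc.prems(1) a, of m] norm_iter_ge_half[OF Suc.prems(2) a, of m] m
      by (simp add: sum_list_addf)
  qed
qed (simp add: sup_norm_add)

lemma norm_iter_scale_le:
  "x \<in> c00 \<Longrightarrow> norm_iter m (\<lambda>i. c * x i) \<le> \<bar>c\<bar> * norm_iter m x"
proof (induction m arbitrary: x)
  case 0
  show ?case
    unfolding norm_iter.simps
    by (rule sup_norm_leI) (use 0 in \<open>auto simp: abs_mult intro!: mult_left_mono abs_le_sup_norm\<close>)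
next
  case (Suc m)
  show ?case
  proof (rule norm_iter_leI)
    show "sup_norm (\<lambda>i. c * x i) \<le> \<bar>c\<bar> * norm_iter (Suc m) x"
    proof (rule sup_norm_leI)
      fix i 
      have "\<bar>x i\<bar> \<le> norm_iter (Suc m) x"
        using abs_le_sup_norm[OF Suc.prems, of i] norm_iter_ge_sup[of x "Suc m"] by linarith
      then show "\<bar>c * x i\<bar> \<le> \<bar>c\<bar> * norm_iter (Suc m) x"
        unfolding abs_mult by (intro mult_left_mono) auto
    qed
    fix Es m' assume m: "Suc m = Suc m'" and a: "admissible 1 Es"
    have "(\<Sum>E\<leftarrow>Es. norm_iter m (restr E (\<lambda>i. c * x i)))
        \<le> (\<Sum>E\<leftarrow>Es. \<bar>c\<bar> * norm_iter m (restr E x))"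
      by (rule sum_list_mono) (use Suc c00_restr in \<open>auto simp: restr_scale\<close>)
    also have "\<dots> = \<bar>c\<bar> * (\<Sum>E\<leftarrow>Es. norm_iter m (restr E x))"
      by (simp add: sum_list_const_mult)
    finally have "1/2 * (\<Sum>E\<leftarrow>Es. norm_iter m (restr E (\<lambda>i. c * x i)))
        \<le> \<bar>c\<bar> * (1/2 * (\<Sum>E\<leftarrow>Es. norm_iter m (restr E x)))" by simp
    also have "\<dots> \<le> \<bar>c\<bar> * norm_iter (Suc m) x"
      by (intro mult_left_mono norm_iter_ge_half Suc.prems a) auto
    finally show "1/2 * (\<Sum>E\<leftarrow>Es. norm_iter m' (restr E (\<lambda>i. c * x i)))
        \<le> \<bar>c\<bar> * norm_iter (Suc m) x" using m by simp
  qed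
qed

lemma norm_iter_restr: "x \<in> c00 \<Longrightarrow> norm_iter m (restr F x) \<le> norm_iter m x"
proof (induction m arbitrary: x)
  case (Suc m)
  show ?case
  proof (rule norm_iter_leI)
    show "sup_norm (restr F x) \<le> norm_iter (Suc m) x"
      using sup_norm_restr[OF Suc.prems] norm_iter_ge_sup order_trans by blast
    fix Es m' assume m: "Suc m = Suc m'" and a: "admissible 1 Es"
    have "(\<Sum>E\<leftarrow>Es. norm_iter m (restr E (restr F x))) \<le> (\<Sum>E\<leftarrow>Es. norm_iter m (restr E x))"
      by (rule sum_list_mono) (metis Suc.IH Suc.prems c00_restr inf_commute restr_restr)
    then show "1/2 * (\<Sum>E\<leftarrow>Es. norm_iter m' (restr E (restr F x))) \<le> norm_iter (Suc m) x"
      using norm_iter_ge_half[OF Suc.prems a, of m] m by simp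
  qed
qed (simp add: sup_norm_restr)

definition norm_lim :: "(nat \<Rightarrow> real) \<Rightarrow> real" where
  "norm_lim x = (if x \<in> c00 then SUP m. norm_iter m x else 0)"

lemma norm_iter_bdd_range: "x \<in> c00 \<Longrightarrow> bdd_above (range (\<lambda>m. norm_iter m x))"
  by (rule bdd_aboveI2) (rule norm_iter_le_l1)

lemma norm_iter_le_lim: "x \<in> c00 \<Longrightarrow> norm_iter m x \<le> norm_lim x"
  unfolding norm_lim_def by (auto intro!: cSUP_upper norm_iter_bdd_range)

lemma norm_iter_tendsto: "x \<in> c00 \<Longrightarrow> (\<lambda>m. norm_iter m x) \<longlonglongrightarrow> norm_lim x"
  unfolding norm_lim_def
  by (auto intro!: LIMSEQ_incseq_SUP norm_iter_bdd_range incseq_SucI norm_iter_mono)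

lemma norm_lim_leI: "x \<in> c00 \<Longrightarrow> (\<And>m. norm_iter m x \<le> c) \<Longrightarrow> norm_lim x \<le> c"
  unfolding norm_lim_def by (auto intro!: cSUP_least)

lemma norm_lim_le_l1: "x \<in> c00 \<Longrightarrow> norm_lim x \<le> l1 x"
  by (rule norm_lim_leI) (auto intro: norm_iter_le_l1)

lemma tendsto_sum_list:
  fixes f :: "nat \<Rightarrow> 'b \<Rightarrow> real"
  assumes "\<And>E. E \<in> set Es \<Longrightarrow> (\<lambda>m. f m E) \<longlonglongrightarrow> g E"
  shows "(\<lambda>m. \<Sum>E\<leftarrow>Es. f m E) \<longlonglongrightarrow> (\<Sum>E\<leftarrow>Es. g E)"
  using assms by (induction Es) (auto intro!: tendsto_add)

lemma norm_lim_equation: "tsirelson_equation norm_lim"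
  unfolding tsirelson_equation_def
proof (intro ballI conjI)
  fix x assume x: "x \<in> c00"
  show bdd: "bdd_above (half_sums norm_lim x)"
    by (rule half_sums_bdd) (use x norm_lim_le_l1 in auto)
  show "norm_lim x = max (sup_norm x) (Sup (half_sums norm_lim x))"
  proof (rule antisym)
    show "norm_lim x \<le> max (sup_norm x) (Sup (half_sums norm_lim x))"
    proof (rule norm_lim_leI[OF x], rule norm_iter_leI)
      fix m Es m' assume a: "admissible 1 Es"
      have "(\<Sum>E\<leftarrow>Es. norm_iter m' (restr E x)) \<le> (\<Sum>E\<leftarrow>Es. norm_lim (restr E x))"
        by (rule sum_list_mono) (use x c00_restr norm_iter_le_lim in auto)
      then show "1/2 * (\<Sum>E\<leftarrow>Es. norm_iter m' (restr E x))
          \<le> max (sup_norm x) (Sup (half_sums norm_lim x))"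
        using half_sums_Sup_ge[OF bdd a] by linarith
    qed simp
    have "sup_norm x \<le> norm_lim x"
      using norm_iter_le_lim[OF x, of 0] by simp
    moreover have "Sup (half_sums norm_lim x) \<le> norm_lim x"
    proof (rule half_sums_Sup_le)
      fix Es assume a: "admissible 1 Es"
      have "(\<lambda>m. 1/2 * (\<Sum>E\<leftarrow>Es. norm_iter m (restr E x)))
          \<longlonglongrightarrow> 1/2 * (\<Sum>E\<leftarrow>Es. norm_lim (restr E x))"
        by (intro tendsto_mult tendsto_const tendsto_sum_list norm_iter_tendsto c00_restr x)
      moreover have "1/2 * (\<Sum>E\<leftarrow>Es. norm_iter m (restr E x)) \<le> norm_lim x" for m
        using norm_iter_ge_half[OF x a, of m] norm_iter_le_lim[OF x, of "Suc m"] by linarith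
      ultimately show "1/2 * (\<Sum>E\<leftarrow>Es. norm_lim (restr E x)) \<le> norm_lim x"
        by (intro LIMSEQ_le_const2) auto
    qed
    ultimately show "max (sup_norm x) (Sup (half_sums norm_lim x)) \<le> norm_lim x" by simp
  qed
qed

lemma norm_lim_scale_le:
  assumes "x \<in> c00" shows "norm_lim (\<lambda>i. c * x i) \<le> \<bar>c\<bar> * norm_lim x"
proof (rule norm_lim_leI[OF c00_scale[OF assms]])
  fix m
  have "norm_iter m (\<lambda>i. c * x i) \<le> \<bar>c\<bar> * norm_iter m x" by (rule norm_iter_scale_le[OF assms])
  also have "\<dots> \<le> \<bar>c\<bar> * norm_lim x"
    by (intro mult_left_mono norm_iter_le_lim assms) auto
  finally show "norm_iter m (\<lambda>i. c * x i) \<le> \<bar>c\<bar> * norm_lim x" .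
qed

lemma norm_lim_norm: "norm_on_c00 norm_lim"
  unfolding norm_on_c00_def
proof (intro conjI ballI allI)
  fix x assume x: "x \<in> c00"
  have s: "sup_norm x \<le> norm_lim x" using norm_iter_le_lim[OF x, of 0] by simp
  show p: "0 \<le> norm_lim x" using s sup_norm_nonneg[OF x] by linarith
  show "(norm_lim x = 0) = (x = (\<lambda>_. 0))"
  proof
    assume "norm_lim x = 0"
    then have "\<bar>x i\<bar> \<le> 0" for i using abs_le_sup_norm[OF x, of i] s by linarith
    then show "x = (\<lambda>_. 0)" by auto
  next
    assume "x = (\<lambda>_. 0)"
    then have "norm_lim x \<le> 0" using norm_lim_le_l1[OF x] by (simp add: l1_def)
    then show "norm_lim x = 0" using p by simp
  qed
next
  fix c x assume x: "x \<in> c00"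
  show "norm_lim (\<lambda>i. c * x i) = \<bar>c\<bar> * norm_lim x"
  proof (cases "c = 0")
    case True
    have "norm_lim (\<lambda>_. 0) \<le> 0" "0 \<le> norm_lim (\<lambda>_. 0)"
      using norm_lim_le_l1[OF c00_zero] norm_iter_le_lim[OF c00_zero, of 0]
        sup_norm_nonneg[OF c00_zero] by (auto simp: l1_def)
    then show ?thesis using True by simp
  next
    case False
    have "norm_lim (\<lambda>i. inverse c * (c * x i)) \<le> \<bar>inverse c\<bar> * norm_lim (\<lambda>i. c * x i)"
      by (rule norm_lim_scale_le[OF c00_scale[OF x]])
    then have "\<bar>c\<bar> * norm_lim x \<le> \<bar>c\<bar> * (\<bar>inverse c\<bar> * norm_lim (\<lambda>i. c * x i))"
      using False by (intro mult_left_mono) (simp_all add: mult.assoc[symmetric])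
    also have "\<dots> = norm_lim (\<lambda>i. c * x i)" using False by (simp add: abs_inverse)
    finally show ?thesis using norm_lim_scale_le[OF x, of c] by simp
  qed
next
  fix x y assume x: "x \<in> c00" and y: "y \<in> c00"
  show "norm_lim (\<lambda>i. x i + y i) \<le> norm_lim x + norm_lim y"
  proof (rule norm_lim_leI[OF c00_add[OF x y]])
    fix m
    show "norm_iter m (\<lambda>i. x i + y i) \<le> norm_lim x + norm_lim y"
      using norm_iter_add[OF x y, of m] norm_iter_le_lim[OF x, of m] norm_iter_le_lim[OF y, of m]
      by linarith
  qed
qed

lemma sum_list_restr_full:
  assumes "sorted_wrt (\<lambda>E F. E \<inter> F = {}) Es" "G \<in> set Es" "{i. x i \<noteq> 0} \<subseteq> G" "N (\<lambda>_. 0) = (0::real)"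
  shows "(\<Sum>E\<leftarrow>Es. N (restr E x)) = N x"
  using assms(1,2)
proof (induction Es)
  case (Cons H Es)
  have z: "N (restr E x) = 0" if "E \<inter> G = {}" for E
  proof -
    have "restr E x = (\<lambda>_. 0)" using that assms(3) by (fastforce simp: restr_def)
    then show ?thesis using assms(4) by simp
  qed
  show ?case
  proof (cases "G = H")
    case True
    have "map (\<lambda>E. N (restr E x)) Es = map (\<lambda>_. 0) Es"
      using Cons.prems True by (intro map_cong) (auto intro!: z)
    then show ?thesis using True restr_supp[OF assms(3)] by (simp only: list.map sum_list.Cons) simp
  next
    case False
    then have "G \<in> set Es" using Cons.prems by simp
    then show ?thesis using Cons z[of H] by auto
  qed
qed simp

lemma tsirelson_equation_le:
  assumes N: "norm_on_c00 N" "tsirelson_equation N"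
    and N': "norm_on_c00 N'" "tsirelson_equation N'"
    and x: "x \<in> c00"
  shows "N x \<le> N' x"
  using x
proof (induction "card {i. x i \<noteq> 0}" arbitrary: x rule: less_induct)
  case less
  note x = less.prems
  have fin: "finite {i. x i \<noteq> 0}" using x by (simp add: c00_def)
  have N0: "N (\<lambda>_. 0) = 0" using N(1) by (auto simp: norm_on_c00_def)
  have eq': "N' x = max (sup_norm x) (Sup (half_sums N' x))" "bdd_above (half_sums N' x)"
    using N'(2) x by (auto simp: tsirelson_equation_def)
  have pos: "0 \<le> N x" "0 \<le> N' x" using N(1) N'(1) x by (auto simp: norm_on_c00_def)
  have "N x \<le> max (N' x) (1/2 * N x)"
  proof -
    have "N x = max (sup_norm x) (Sup (half_sums N x))"
      using N(2) x by (auto simp: tsirelson_equation_def)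
    moreover have "Sup (half_sums N x) \<le> max (N' x) (1/2 * N x)"
    proof (rule half_sums_Sup_le)
      fix Es assume a: "admissible 1 Es"
      show "1/2 * (\<Sum>E\<leftarrow>Es. N (restr E x)) \<le> max (N' x) (1/2 * N x)"
      proof (cases "\<exists>G\<in>set Es. {i. x i \<noteq> 0} \<subseteq> G")
        case True
        then show ?thesis
          using sum_list_restr_full[OF admissible_disjoint[OF a], of _ x N] N0 by auto
      next
        case False
        have "N (restr E x) \<le> N' (restr E x)" if "E \<in> set Es" for E
        proof (rule less.hyps)
          show "restr E x \<in> c00" by (rule c00_restr[OF x])
          have "{i. restr E x i \<noteq> 0} \<subset> {i. x i \<noteq> 0}"
            using False that by (auto simp: restr_def)
          then show "card {i. restr E x i \<noteq> 0} < card {i. x i \<noteq> 0}"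
            by (rule psubset_card_mono[OF fin])
        qed
        then have "(\<Sum>E\<leftarrow>Es. N (restr E x)) \<le> (\<Sum>E\<leftarrow>Es. N' (restr E x))"
          by (rule sum_list_mono)
        then show ?thesis using half_sums_Sup_ge[OF eq'(2) a] eq'(1) by linarith
      qed
    qed
    ultimately show ?thesis using eq'(1) by linarith
  qed
  then show ?case using pos by linarith
qed

theorem ex1_tsirelson_norm:
  "\<exists>!N. norm_on_c00 N \<and> tsirelson_equation N \<and> (\<forall>x. x \<notin> c00 \<longrightarrow> N x = 0)"
proof (rule ex1I)
  show "norm_on_c00 norm_lim \<and> tsirelson_equation norm_lim \<and> (\<forall>x. x \<notin> c00 \<longrightarrow> norm_lim x = 0)"
    using norm_lim_norm norm_lim_equation by (simp add: norm_lim_def)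
  fix N assume N: "norm_on_c00 N \<and> tsirelson_equation N \<and> (\<forall>x. x \<notin> c00 \<longrightarrow> N x = 0)"
  show "N = norm_lim"
  proof
    fix x show "N x = norm_lim x"
    proof (cases "x \<in> c00")
      case True
      then show ?thesis
        using N norm_lim_norm norm_lim_equation
        by (intro antisym tsirelson_equation_le) auto
    qed (use N in \<open>simp add: norm_lim_def\<close>)
  qed
qed

lemma tsirelson_norm_eq_lim: "tsirelson_norm = norm_lim"
  unfolding tsirelson_norm_def
  by (rule the1_equality[OF ex1_tsirelson_norm])
     (use norm_lim_norm norm_lim_equation in \<open>simp add: norm_lim_def\<close>)

lemma tsirelson_norm_equation: "tsirelson_equation tsirelson_norm"
  by (simp add: tsirelson_norm_eq_lim norm_lim_equation)

lemma tsirelson_norm_on_c00: "norm_on_c00 tsirelson_norm"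
  by (simp add: tsirelson_norm_eq_lim norm_lim_norm)

section \<open>Tsirelson's space\<close>

lemma tn_nonneg: "x \<in> c00 \<Longrightarrow> 0 \<le> tsirelson_norm x"
  using tsirelson_norm_on_c00 by (auto simp: norm_on_c00_def)

lemma tn_add:
  "x \<in> c00 \<Longrightarrow> y \<in> c00 \<Longrightarrow> tsirelson_norm (\<lambda>i. x i + y i) \<le> tsirelson_norm x + tsirelson_norm y"
  using tsirelson_norm_on_c00 by (auto simp: norm_on_c00_def)

lemma tn_scale: "x \<in> c00 \<Longrightarrow> tsirelson_norm (\<lambda>i. c * x i) = \<bar>c\<bar> * tsirelson_norm x"
  using tsirelson_norm_on_c00 by (auto simp: norm_on_c00_def)

lemma tn_zero: "tsirelson_norm (\<lambda>_. 0) = 0"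
  using tsirelson_norm_on_c00 by (auto simp: norm_on_c00_def)

lemma tn_restr: "x \<in> c00 \<Longrightarrow> tsirelson_norm (restr F x) \<le> tsirelson_norm x"
  unfolding tsirelson_norm_eq_lim
  by (rule norm_lim_leI[OF c00_restr]) (meson norm_iter_le_lim norm_iter_restr order_trans)+

lemma sup_norm_le_tn: "x \<in> c00 \<Longrightarrow> sup_norm x \<le> tsirelson_norm x"
  using tsirelson_norm_equation by (auto simp: tsirelson_equation_def)

lemma tn_half_sum:
  assumes "x \<in> c00" "admissible 1 Es"
  shows "1/2 * (\<Sum>E\<leftarrow>Es. tsirelson_norm (restr E x)) \<le> tsirelson_norm x"
proof -
  have "bdd_above (half_sums tsirelson_norm x)"
    "tsirelson_norm x = max (sup_norm x) (Sup (half_sums tsirelson_norm x))"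
    using tsirelson_norm_equation assms(1) by (auto simp: tsirelson_equation_def)
  then show ?thesis using half_sums_Sup_ge[OF _ assms(2), of tsirelson_norm x] by linarith
qed

lemma tn_restr_le_sum:
  assumes "finite F" "x 0 = 0"
  shows "tsirelson_norm (restr F x) \<le> (\<Sum>i\<in>F. \<bar>x i\<bar>)"
proof -
  have "tsirelson_norm (restr F x) \<le> l1 (restr F x)"
    unfolding tsirelson_norm_eq_lim by (rule norm_lim_le_l1[OF c00_restr_finite[of x F, OF assms(2,1)]])
  also have "\<dots> = (\<Sum>i\<in>F. \<bar>restr F x i\<bar>)"
    by (rule l1_eq) (use assms in \<open>auto simp: restr_def split: if_splits\<close>)
  also have "\<dots> = (\<Sum>i\<in>F. \<bar>x i\<bar>)"
    by (rule sum.cong) (auto simp: restr_def)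
  finally show ?thesis .
qed

lemma tn_restr_mono:
  assumes "finite G" "x 0 = 0" "F \<subseteq> G"
  shows "tsirelson_norm (restr F x) \<le> tsirelson_norm (restr G x)"
proof -
  have "restr F x = restr F (restr G x)" using assms(3) by (simp add: restr_restr Int_absorb2)
  then show ?thesis using tn_restr[OF c00_restr_finite[of x G, OF assms(2,1)]] by simp
qed

text \<open>
  The completion of \<^const>\<open>c00\<close> is realised by the sequences \<open>x\<close> for which the series
  \<open>\<Sum>i. x(i) e\<^sub>i\<close> is Cauchy in the Tsirelson norm, with the limit of the norms of the partial sums
  as norm.  This is a completion: the space is a Banach space (class instance below), the
  norm extends \<^const>\<open>tsirelson_norm\<close> (\<open>norm_Tsirelson_c00\<close>), and the finitely supported
  sequences are dense (\<open>closed_span_unit_basis\<close>).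
\<close>

typedef tsirelson =
  "{x :: nat \<Rightarrow> real. x 0 = 0 \<and>
      (\<forall>\<epsilon>>0. \<exists>M. \<forall>m\<ge>M. \<forall>k\<ge>m. tsirelson_norm (restr {m<..k} x) < \<epsilon>)}"
  morphisms coord Tsirelson
  by (rule exI[of _ "\<lambda>_. 0"]) (simp add: restr_def tn_zero)

definition tseq :: "(nat \<Rightarrow> real) \<Rightarrow> bool" where
  "tseq x \<longleftrightarrow> x 0 = 0 \<and> (\<forall>\<epsilon>>0. \<exists>M. \<forall>m\<ge>M. \<forall>k\<ge>m. tsirelson_norm (restr {m<..k} x) < \<epsilon>)"

lemma tseq_coord: "tseq (coord x)"
  using coord[of x] by (simp add: tseq_def)

lemma coord_0 [simp]: "coord x 0 = 0"
  using tseq_coord[of x] by (simp add: tseq_def)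

lemma coord_Tsirelson: "tseq x \<Longrightarrow> coord (Tsirelson x) = x"
  by (rule Tsirelson_inverse) (simp add: tseq_def)

lemma tsirelson_eqI: "(\<And>i. coord x i = coord y i) \<Longrightarrow> x = y"
  by (metis coord_inject ext)

lemma tseq_c00:
  assumes "x \<in> c00" shows "tseq x"
  unfolding tseq_def
proof (intro conjI allI impI)
  show "x 0 = 0" using assms by (simp add: c00_def)
  fix \<epsilon> :: real assume e: "\<epsilon> > 0"
  obtain M where M: "\<forall>i\<in>{i. x i \<noteq> 0}. i \<le> M"
    using assms by (auto simp: c00_def finite_nat_set_iff_bounded_le)
  have "restr {m<..k} x = (\<lambda>_. 0)" if "M \<le> m" for m k
    using M that by (force simp: restr_def)
  then show "\<exists>M. \<forall>m\<ge>M. \<forall>k\<ge>m. tsirelson_norm (restr {m<..k} x) < \<epsilon>"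
    using e by (intro exI[of _ M]) (auto simp: tn_zero)
qed

lemma tseq_zero: "tseq (\<lambda>_. 0)"
  by (rule tseq_c00) simp

lemma tseq_add:
  assumes "tseq x" "tseq y" shows "tseq (\<lambda>i. x i + y i)"
  unfolding tseq_def
proof (intro conjI allI impI)
  show "x 0 + y 0 = 0" using assms by (simp add: tseq_def)
  fix \<epsilon> :: real assume "\<epsilon> > 0"
  then have e: "\<epsilon>/2 > 0" by simp
  obtain M1 where M1: "\<forall>m\<ge>M1. \<forall>k\<ge>m. tsirelson_norm (restr {m<..k} x) < \<epsilon>/2"
    using assms(1) e unfolding tseq_def by blast
  obtain M2 where M2: "\<forall>m\<ge>M2. \<forall>k\<ge>m. tsirelson_norm (restr {m<..k} y) < \<epsilon>/2"
    using assms(2) e unfolding tseq_def by blast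
  show "\<exists>M. \<forall>m\<ge>M. \<forall>k\<ge>m. tsirelson_norm (restr {m<..k} (\<lambda>i. x i + y i)) < \<epsilon>"
  proof (intro exI[of _ "max M1 M2"] allI impI)
    fix m k assume "max M1 M2 \<le> m" "m \<le> k"
    then have "tsirelson_norm (restr {m<..k} x) < \<epsilon>/2" "tsirelson_norm (restr {m<..k} y) < \<epsilon>/2"
      using M1 M2 by auto
    moreover have "tsirelson_norm (restr {m<..k} (\<lambda>i. x i + y i))
        \<le> tsirelson_norm (restr {m<..k} x) + tsirelson_norm (restr {m<..k} y)"
      unfolding restr_add by (intro tn_add c00_restr_finite) (use assms in \<open>auto simp: tseq_def\<close>)
    ultimately show "tsirelson_norm (restr {m<..k} (\<lambda>i. x i + y i)) < \<epsilon>" by linarith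
  qed
qed

lemma tseq_scale:
  assumes "tseq x" shows "tseq (\<lambda>i. c * x i)"
  unfolding tseq_def
proof (intro conjI allI impI)
  show "c * x 0 = 0" using assms by (simp add: tseq_def)
  fix \<epsilon> :: real assume e0: "\<epsilon> > 0"
  then have e: "\<epsilon>/(\<bar>c\<bar> + 1) > 0" by simp
  obtain M where M: "\<forall>m\<ge>M. \<forall>k\<ge>m. tsirelson_norm (restr {m<..k} x) < \<epsilon>/(\<bar>c\<bar> + 1)"
    using assms(1) e unfolding tseq_def by blast
  show "\<exists>M. \<forall>m\<ge>M. \<forall>k\<ge>m. tsirelson_norm (restr {m<..k} (\<lambda>i. c * x i)) < \<epsilon>"
  proof (intro exI[of _ M] allI impI)
    fix m k assume mk: "M \<le> m" "m \<le> k"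
    have x: "restr {m<..k} x \<in> c00"
      by (rule c00_restr_finite) (use assms in \<open>auto simp: tseq_def\<close>)
    have "tsirelson_norm (restr {m<..k} (\<lambda>i. c * x i)) = \<bar>c\<bar> * tsirelson_norm (restr {m<..k} x)"
      unfolding restr_scale by (rule tn_scale[OF x])
    also have "\<dots> \<le> (\<bar>c\<bar> + 1) * tsirelson_norm (restr {m<..k} x)"
      by (intro mult_right_mono tn_nonneg x) simp
    also have "\<dots> < (\<bar>c\<bar> + 1) * (\<epsilon>/(\<bar>c\<bar> + 1))"
      by (intro mult_strict_left_mono) (use M mk in auto)
    also have "\<dots> = \<epsilon>" by simp
    finally show "tsirelson_norm (restr {m<..k} (\<lambda>i. c * x i)) < \<epsilon>" .
  qed
qed

lemma tseq_uminus: "tseq x \<Longrightarrow> tseq (\<lambda>i. - x i)"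
  using tseq_scale[of x "-1"] by simp

lemma tseq_diff: "tseq x \<Longrightarrow> tseq y \<Longrightarrow> tseq (\<lambda>i. x i - y i)"
  using tseq_add[OF _ tseq_uminus, of x y] by simp

lemma tseq_partial_bdd:
  assumes "tseq x"
  shows "\<exists>C. \<forall>m. tsirelson_norm (restr {..m} x) \<le> C"
proof -
  have x0: "x 0 = 0" using assms by (simp add: tseq_def)
  obtain M where M: "\<forall>m\<ge>M. \<forall>k\<ge>m. tsirelson_norm (restr {m<..k} x) < 1"
    using assms zero_less_one unfolding tseq_def by blast
  have "tsirelson_norm (restr {..m} x) \<le> tsirelson_norm (restr {..M} x) + 1" for m
  proof -
    have "tsirelson_norm (restr {..m} x) \<le> tsirelson_norm (restr {..max m M} x)"
      by (rule tn_restr_mono) (use x0 in auto)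
    also have "restr {..max m M} x = (\<lambda>i. restr {..M} x i + restr {M<..max m M} x i)"
      by (auto simp: restr_def fun_eq_iff)
    also have "tsirelson_norm \<dots>
        \<le> tsirelson_norm (restr {..M} x) + tsirelson_norm (restr {M<..max m M} x)"
      by (intro tn_add c00_restr_finite) (use x0 in auto)
    finally show ?thesis using M[rule_format, of M "max m M"] by simp
  qed
  then show ?thesis by blast
qed

lemma tseq_partial_convergent:
  assumes "tseq x"
  shows "(\<lambda>m. tsirelson_norm (restr {..m} x)) \<longlonglongrightarrow> lim (\<lambda>m. tsirelson_norm (restr {..m} x))"
    and "tsirelson_norm (restr {..m} x) \<le> lim (\<lambda>m. tsirelson_norm (restr {..m} x))"
proof -
  have x0: "x 0 = 0" using assms by (simp add: tseq_def)
  have inc: "incseq (\<lambda>m. tsirelson_norm (restr {..m} x))"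
    by (rule incseq_SucI, rule tn_restr_mono) (use x0 in auto)
  obtain C where "\<forall>m. tsirelson_norm (restr {..m} x) \<le> C"
    using tseq_partial_bdd[OF assms] by blast
  then obtain L where L: "(\<lambda>m. tsirelson_norm (restr {..m} x)) \<longlonglongrightarrow> L"
    "\<forall>i. tsirelson_norm (restr {..i} x) \<le> L"
    using incseq_convergent[OF inc] by metis
  then show "(\<lambda>m. tsirelson_norm (restr {..m} x)) \<longlonglongrightarrow> lim (\<lambda>m. tsirelson_norm (restr {..m} x))"
    "tsirelson_norm (restr {..m} x) \<le> lim (\<lambda>m. tsirelson_norm (restr {..m} x))"
    using limI[OF L(1)] by auto
qed

instantiation tsirelson :: real_normed_vector
begin

definition zero_tsirelson :: tsirelson where
  "0 = Tsirelson (\<lambda>_. 0)"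

definition plus_tsirelson :: "tsirelson \<Rightarrow> tsirelson \<Rightarrow> tsirelson" where
  "x + y = Tsirelson (\<lambda>i. coord x i + coord y i)"

definition minus_tsirelson :: "tsirelson \<Rightarrow> tsirelson \<Rightarrow> tsirelson" where
  "x - y = Tsirelson (\<lambda>i. coord x i - coord y i)"

definition uminus_tsirelson :: "tsirelson \<Rightarrow> tsirelson" where
  "- x = Tsirelson (\<lambda>i. - coord x i)"

definition scaleR_tsirelson :: "real \<Rightarrow> tsirelson \<Rightarrow> tsirelson" where
  "c *\<^sub>R x = Tsirelson (\<lambda>i. c * coord x i)"

definition norm_tsirelson :: "tsirelson \<Rightarrow> real" where
  "norm x = lim (\<lambda>m. tsirelson_norm (restr {..m} (coord x)))"

definition dist_tsirelson :: "tsirelson \<Rightarrow> tsirelson \<Rightarrow> real" where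
  "dist (x :: tsirelson) y = norm (x - y)"

definition sgn_tsirelson :: "tsirelson \<Rightarrow> tsirelson" where
  "sgn (x :: tsirelson) = inverse (norm x) *\<^sub>R x"

definition uniformity_tsirelson :: "(tsirelson \<times> tsirelson) filter" where
  "uniformity = (INF e\<in>{0<..}. principal {(x :: tsirelson, y). dist x y < e})"

definition open_tsirelson :: "tsirelson set \<Rightarrow> bool" where
  "open (S :: tsirelson set) \<longleftrightarrow> (\<forall>x\<in>S. \<forall>\<^sub>F (x', y) in uniformity. x' = x \<longrightarrow> y \<in> S)"

lemma coord_zero: "coord 0 = (\<lambda>_. 0)"
  by (simp add: zero_tsirelson_def coord_Tsirelson tseq_zero)

lemma coord_plus: "coord (x + y) = (\<lambda>i. coord x i + coord y i)"
  by (simp add: plus_tsirelson_def coord_Tsirelson tseq_add tseq_coord)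

lemma coord_minus: "coord (x - y) = (\<lambda>i. coord x i - coord y i)"
  by (simp add: minus_tsirelson_def coord_Tsirelson tseq_diff tseq_coord)

lemma coord_uminus: "coord (- x) = (\<lambda>i. - coord x i)"
  by (simp add: uminus_tsirelson_def coord_Tsirelson tseq_uminus tseq_coord)

lemma coord_scaleR: "coord (c *\<^sub>R x) = (\<lambda>i. c * coord x i)"
  by (simp add: scaleR_tsirelson_def coord_Tsirelson tseq_scale tseq_coord)

lemmas coord_simps = coord_zero coord_plus coord_minus coord_uminus coord_scaleR

lemma partial_tendsto_norm:
  "(\<lambda>m. tsirelson_norm (restr {..m} (coord x))) \<longlonglongrightarrow> norm x"
  unfolding norm_tsirelson_def by (rule tseq_partial_convergent(1)[OF tseq_coord])

lemma partial_le_norm: "tsirelson_norm (restr {..m} (coord x)) \<le> norm x"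
  unfolding norm_tsirelson_def by (rule tseq_partial_convergent(2)[OF tseq_coord])

lemma norm_tsirelson_leI:
  "(\<And>m. tsirelson_norm (restr {..m} (coord x)) \<le> c) \<Longrightarrow> norm x \<le> c"
  by (rule LIMSEQ_le_const2[OF partial_tendsto_norm]) auto

lemma restr_coord_c00: "finite F \<Longrightarrow> restr F (coord x) \<in> c00"
  by (rule c00_restr_finite) auto

lemma tn_restr_le_norm:
  assumes "finite F" shows "tsirelson_norm (restr F (coord x)) \<le> norm x"
proof -
  obtain m where "F \<subseteq> {..m}" using assms finite_nat_set_iff_bounded_le by auto
  then have "tsirelson_norm (restr F (coord x)) \<le> tsirelson_norm (restr {..m} (coord x))"
    by (intro tn_restr_mono) auto
  then show ?thesis using partial_le_norm order_trans by blast
qed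

lemma abs_coord_le_norm: "\<bar>coord x i\<bar> \<le> norm x"
proof -
  have "\<bar>restr {i} (coord x) i\<bar> \<le> tsirelson_norm (restr {i} (coord x))"
    using abs_le_sup_norm sup_norm_le_tn restr_coord_c00[of "{i}" x] order_trans by blast
  then show ?thesis using tn_restr_le_norm[of "{i}" x] by (simp add: restr_def)
qed

instance
proof
  fix x y z :: tsirelson and a b :: real
  show "x + y + z = x + (y + z)" "x + y = y + x" "0 + x = x" "- x + x = 0" "x - y = x + - y"
    "a *\<^sub>R (x + y) = a *\<^sub>R x + a *\<^sub>R y" "(a + b) *\<^sub>R x = a *\<^sub>R x + b *\<^sub>R x"
    "a *\<^sub>R b *\<^sub>R x = (a * b) *\<^sub>R x" "1 *\<^sub>R x = x"
    by (auto intro!: tsirelson_eqI simp: coord_simps algebra_simps)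
  show "dist x y = norm (x - y)" by (fact dist_tsirelson_def)
  show "sgn x = inverse (norm x) *\<^sub>R x" by (fact sgn_tsirelson_def)
  show "uniformity = (INF e\<in>{0<..}. principal {(x, y :: tsirelson). dist x y < e})"
    by (fact uniformity_tsirelson_def)
  show "open U \<longleftrightarrow> (\<forall>x\<in>U. \<forall>\<^sub>F (x', y) in uniformity. x' = x \<longrightarrow> y \<in> U)" for U :: "tsirelson set"
    by (fact open_tsirelson_def)
  show "(norm x = 0) = (x = 0)"
  proof
    assume "norm x = 0"
    then have "coord x i = 0" for i using abs_coord_le_norm[of x i] by simp
    then show "x = 0" by (intro tsirelson_eqI) (simp add: coord_zero)
  next
    assume "x = 0"
    then have "(\<lambda>m. tsirelson_norm (restr {..m} (coord x))) = (\<lambda>_. 0)"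
      by (auto simp: coord_zero restr_def tn_zero)
    then show "norm x = 0" using partial_tendsto_norm[of x] by (metis LIMSEQ_const_iff)
  qed
  show "norm (x + y) \<le> norm x + norm y"
  proof (rule norm_tsirelson_leI)
    fix m
    have "tsirelson_norm (restr {..m} (coord (x + y)))
        \<le> tsirelson_norm (restr {..m} (coord x)) + tsirelson_norm (restr {..m} (coord y))"
      unfolding coord_plus restr_add by (intro tn_add restr_coord_c00) auto
    then show "tsirelson_norm (restr {..m} (coord (x + y))) \<le> norm x + norm y"
      using partial_le_norm[of m x] partial_le_norm[of m y] by linarith
  qed
  have "(\<lambda>m. \<bar>a\<bar> * tsirelson_norm (restr {..m} (coord x))) \<longlonglongrightarrow> \<bar>a\<bar> * norm x"
    by (intro tendsto_intros partial_tendsto_norm)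
  moreover have "\<bar>a\<bar> * tsirelson_norm (restr {..m} (coord x))
      = tsirelson_norm (restr {..m} (coord (a *\<^sub>R x)))" for m
    unfolding coord_scaleR restr_scale by (rule tn_scale[symmetric], rule restr_coord_c00) simp
  ultimately have "(\<lambda>m. tsirelson_norm (restr {..m} (coord (a *\<^sub>R x)))) \<longlonglongrightarrow> \<bar>a\<bar> * norm x"
    by simp
  then show "norm (a *\<^sub>R x) = \<bar>a\<bar> * norm x"
    using partial_tendsto_norm[of "a *\<^sub>R x"] LIMSEQ_unique by blast
qed

end

instance tsirelson :: banach
proof
  fix X :: "nat \<Rightarrow> tsirelson" assume X: "Cauchy X"
  define c where "c = (\<lambda>n i. coord (X n) i)"
  have c0: "c n 0 = 0" for n by (simp add: c_def)
  have "convergent (\<lambda>n. c n i)" for i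
  proof (rule real_Cauchy_convergent, rule CauchyI)
    fix e :: real assume "e > 0"
    then obtain M where M: "\<forall>m\<ge>M. \<forall>n\<ge>M. norm (X m - X n) < e" using CauchyD[OF X] by blast
    have "norm (c m i - c n i) < e" if "m \<ge> M" "n \<ge> M" for m n
      using abs_coord_le_norm[of "X m - X n" i] M that by (force simp: coord_minus c_def)
    then show "\<exists>M. \<forall>m\<ge>M. \<forall>n\<ge>M. norm (c m i - c n i) < e" by blast
  qed
  then have lim: "(\<lambda>n. c n i) \<longlonglongrightarrow> lim (\<lambda>n. c n i)" for i
    by (simp add: convergent_LIMSEQ_iff)
  define z where "z = (\<lambda>i. lim (\<lambda>n. c n i))"
  have cz: "(\<lambda>n. c n i) \<longlonglongrightarrow> z i" for i using lim by (simp add: z_def)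
  have z0: "z 0 = 0" using cz[of 0] by (simp add: c0 LIMSEQ_const_iff)
  have close: "tsirelson_norm (restr F (\<lambda>i. c n i - z i)) \<le> e"
    if F: "finite F" and M: "\<forall>m\<ge>M. \<forall>n\<ge>M. norm (X m - X n) < e" "n \<ge> M" for F n M e
  proof -
    have "tsirelson_norm (restr F (\<lambda>i. c n i - z i)) \<le> e + (\<Sum>i\<in>F. \<bar>c m i - z i\<bar>)" if "m \<ge> M" for m
    proof -
      have eq: "restr F (\<lambda>i. c n i - z i)
          = (\<lambda>i. restr F (coord (X n - X m)) i + restr F (\<lambda>i. c m i - z i) i)"
        by (auto simp: restr_def c_def coord_minus)
      have "tsirelson_norm (restr F (\<lambda>i. c n i - z i))
          \<le> tsirelson_norm (restr F (coord (X n - X m))) + tsirelson_norm (restr F (\<lambda>i. c m i - z i))"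
        unfolding eq by (intro tn_add c00_restr_finite F) (auto simp: c0 z0)
      moreover have "tsirelson_norm (restr F (coord (X n - X m))) \<le> norm (X n - X m)"
        by (rule tn_restr_le_norm[OF F])
      moreover have "norm (X n - X m) \<le> e" using M that by (meson less_imp_le)
      moreover have "tsirelson_norm (restr F (\<lambda>i. c m i - z i)) \<le> (\<Sum>i\<in>F. \<bar>c m i - z i\<bar>)"
        by (rule tn_restr_le_sum[OF F]) (simp add: c0 z0)
      ultimately show ?thesis by linarith
    qed
    moreover have "(\<lambda>m. e + (\<Sum>i\<in>F. \<bar>c m i - z i\<bar>)) \<longlonglongrightarrow> e + (\<Sum>i\<in>F. \<bar>z i - z i\<bar>)"
      by (intro tendsto_intros cz)
    ultimately show ?thesis
      by (intro LIMSEQ_le_const[of _ e]) auto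
  qed
  have tz: "tseq z"
    unfolding tseq_def
  proof (intro conjI allI impI)
    fix \<epsilon> :: real assume e: "\<epsilon> > 0"
    obtain N where N: "\<forall>m\<ge>N. \<forall>n\<ge>N. norm (X m - X n) < \<epsilon>/2" using CauchyD[OF X, of "\<epsilon>/2"] e by auto
    obtain M where M: "\<forall>m\<ge>M. \<forall>k\<ge>m. tsirelson_norm (restr {m<..k} (coord (X N))) < \<epsilon>/2"
      using tseq_coord[of "X N"] e unfolding tseq_def by (meson half_gt_zero)
    show "\<exists>M. \<forall>m\<ge>M. \<forall>k\<ge>m. tsirelson_norm (restr {m<..k} z) < \<epsilon>"
    proof (intro exI[of _ M] allI impI)
      fix m k assume mk: "M \<le> m" "m \<le> k"
      let ?F = "{m<..k}"
      have eq: "restr ?F z = (\<lambda>i. restr ?F (coord (X N)) i + (-1) * restr ?F (\<lambda>i. c N i - z i) i)"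
        by (auto simp: restr_def c_def)
      have "tsirelson_norm (restr ?F z) \<le> tsirelson_norm (restr ?F (coord (X N)))
          + tsirelson_norm (\<lambda>i. (-1) * restr ?F (\<lambda>i. c N i - z i) i)"
        unfolding eq by (intro tn_add c00_scale c00_restr_finite) (auto simp: c0 z0)
      moreover have "tsirelson_norm (\<lambda>i. (-1) * restr ?F (\<lambda>i. c N i - z i) i)
          = tsirelson_norm (restr ?F (\<lambda>i. c N i - z i))"
        by (subst tn_scale) (auto intro!: c00_restr_finite simp: c0 z0)
      moreover have "tsirelson_norm (restr ?F (\<lambda>i. c N i - z i)) \<le> \<epsilon>/2"
        by (rule close[OF _ N]) auto
      moreover have "tsirelson_norm (restr ?F (coord (X N))) < \<epsilon>/2" using M mk by blast
      ultimately show "tsirelson_norm (restr ?F z) < \<epsilon>" by linarith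
    qed
  qed (rule z0)
  have "X \<longlonglongrightarrow> Tsirelson z"
  proof (rule LIMSEQ_I)
    fix r :: real assume r: "r > 0"
    obtain N where N: "\<forall>m\<ge>N. \<forall>n\<ge>N. norm (X m - X n) < r/2" using CauchyD[OF X, of "r/2"] r by auto
    have "norm (X n - Tsirelson z) \<le> r/2" if "n \<ge> N" for n
    proof (rule norm_tsirelson_leI)
      fix m show "tsirelson_norm (restr {..m} (coord (X n - Tsirelson z))) \<le> r/2"
        using close[OF _ N that, of "{..m}"] by (simp add: coord_minus coord_Tsirelson[OF tz] c_def)
    qed
    then show "\<exists>N. \<forall>n\<ge>N. norm (X n - Tsirelson z) < r" using r by (intro exI[of _ N]) force
  qed
  then show "convergent X" by (rule convergentI)
qed

lemma norm_Tsirelson_c00: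
  assumes "x \<in> c00" shows "norm (Tsirelson x) = tsirelson_norm x"
proof -
  have c: "coord (Tsirelson x) = x" by (rule coord_Tsirelson[OF tseq_c00[OF assms]])
  obtain M where M: "{i. x i \<noteq> 0} \<subseteq> {..M}"
    using assms by (auto simp: c00_def finite_nat_set_iff_bounded_le)
  show ?thesis
  proof (rule antisym)
    show "norm (Tsirelson x) \<le> tsirelson_norm x"
      by (rule norm_tsirelson_leI) (simp add: c tn_restr[OF assms])
    show "tsirelson_norm x \<le> norm (Tsirelson x)"
      using partial_le_norm[of M "Tsirelson x"] by (simp add: c restr_supp[OF M])
  qed
qed

text \<open>
  Sequences of vectors are indexed from \<open>0\<close>, so \<open>unit_basis i\<close> is the unit vector
  of the coordinate \<open>i + 1\<close>.
\<close>

definition unit_basis :: "nat \<Rightarrow> tsirelson" where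
  "unit_basis i = Tsirelson (\<lambda>j. if j = Suc i then 1 else 0)"

lemma coord_unit_basis: "coord (unit_basis i) j = (if j = Suc i then 1 else 0)"
  unfolding unit_basis_def by (subst coord_Tsirelson) (auto intro!: tseq_c00 simp: c00_def)

definition closed_span :: "(nat \<Rightarrow> 'a::real_normed_vector) \<Rightarrow> 'a set" where
  "closed_span y = closure (span (range y))"

lemma closed_span_unit_basis: "closed_span unit_basis = UNIV"
proof -
  have "x \<in> closure (span (range unit_basis))" for x
    unfolding closure_approachable
  proof (intro allI impI)
    fix e :: real assume e: "e > 0"
    obtain M where M: "\<forall>m\<ge>M. \<forall>k\<ge>m. tsirelson_norm (restr {m<..k} (coord x)) < e/2"
      using tseq_coord[of x] e unfolding tseq_def by (meson half_gt_zero)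
    define y where "y = (\<Sum>i<M. coord x (Suc i) *\<^sub>R unit_basis i)"
    have cs: "coord (\<Sum>i<N. coord x (Suc i) *\<^sub>R unit_basis i) = restr {..N} (coord x)" for N
      by (induction N) (auto simp: coord_simps coord_unit_basis restr_def fun_eq_iff le_Suc_eq)
    have "y \<in> span (range unit_basis)"
      unfolding y_def by (intro span_sum span_scale span_base) auto
    moreover have "norm (y - x) \<le> e/2"
    proof -
      have "norm (x - y) \<le> e/2"
      proof (rule norm_tsirelson_leI)
        fix m
        have "restr {..m} (coord (x - y)) = restr {M<..m} (coord x)"
          by (auto simp: coord_minus y_def cs restr_def)
        then have "tsirelson_norm (restr {..m} (coord (x - y)))
            \<le> tsirelson_norm (restr {M<..max M m} (coord x))"
          by (simp only:) (rule tn_restr_mono, auto)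
        also have "\<dots> \<le> e/2" using M[rule_format, of M "max M m"] by simp
        finally show "tsirelson_norm (restr {..m} (coord (x - y))) \<le> e/2" .
      qed
      then show ?thesis by (simp add: norm_minus_commute)
    qed
    ultimately show "\<exists>y\<in>span (range unit_basis). dist y x < e"
      using e by (intro bexI[of _ y]) (auto simp: dist_norm)
  qed
  then show ?thesis by (auto simp: closed_span_def)
qed


section \<open>Block subspaces\<close>

definition block_basis :: "(nat \<Rightarrow> 'a::real_vector) \<Rightarrow> (nat \<Rightarrow> 'a) \<Rightarrow> bool" where
  "block_basis x y \<longleftrightarrow>
     (\<exists>p a. strict_mono p \<and>
        (\<forall>i. y i = (\<Sum>k\<in>{p i..<p (Suc i)}. a k *\<^sub>R x k) \<and> y i \<noteq> 0))"

text \<open>\<open>Y \<prec> T\<close>:\<close>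

definition block_subspace :: "tsirelson set \<Rightarrow> bool" where
  "block_subspace Y \<longleftrightarrow> (\<exists>y. block_basis unit_basis y \<and> Y = closed_span y)"

text \<open>
  \<open>Z \<prec> Y\<close>, where \<open>Y \<prec> T\<close>.  The block basis \<open>y\<close> of the unit vector basis that spans \<open>Y\<close> is unique
  up to nonzero scalar factors, so this does not depend on its choice.
\<close>

definition block_subspace_of :: "tsirelson set \<Rightarrow> tsirelson set \<Rightarrow> bool" where
  "block_subspace_of Z Y \<longleftrightarrow>
     (\<exists>y z. block_basis unit_basis y \<and> Y = closed_span y \<and> block_basis y z \<and> Z = closed_span z)"

definition unit_sphere :: "tsirelson set \<Rightarrow> tsirelson set" where
  "unit_sphere Z = {z \<in> Z. norm z = 1}"


section \<open>Admissible trees and the norms they define\<close>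

text \<open>
  Trees are indexed by nodes rather than by sets: a nonempty set may be its own only successor
  (as a one-element admissible partition).  Without this no set that contains \<open>1\<close> could have
  successors and \<open>tree_norm j n\<close> would vanish on the first unit vector for \<open>j \<ge> 1\<close>.
\<close>

datatype set_tree = Node (node_set: "nat set") (successors: "set_tree list")

fun admissible_tree :: "set_tree \<Rightarrow> bool" where
  "admissible_tree (Node E ts) \<longleftrightarrow>
     finite E \<and> 0 \<notin> E \<and>
     (ts \<noteq> [] \<longrightarrow> admissible 1 (map node_set ts) \<and> \<Union>(set (map node_set ts)) = E) \<and>
     (\<forall>t\<in>set ts. admissible_tree t)"

text \<open>The terminal sets together with their levels, if the root has level \<open>m\<close>:\<close>

fun terminals :: "nat \<Rightarrow> set_tree \<Rightarrow> (nat \<times> nat set) list" where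
  "terminals m (Node E ts) =
     (if ts = [] then [(m, E)] else concat (map (terminals (Suc m)) ts))"

text \<open>In the sum, a terminal set of level \<open>l = j + n * k\<close> has the weight \<open>2 powr (-(j + n * k))\<close>.\<close>

definition tree_norm :: "nat \<Rightarrow> nat \<Rightarrow> tsirelson \<Rightarrow> real" where
  "tree_norm j n x =
     Sup {(\<Sum>(l, E)\<leftarrow>terminals 0 t. (1/2) ^ l * sup_norm (restr E (coord x))) | t.
       admissible_tree t \<and> (\<forall>(l, E)\<in>set (terminals 0 t). \<exists>k. l = j + n * k)}"

lemma tree_sum_le:
  "admissible_tree t \<Longrightarrow>
     (\<Sum>(l, E)\<leftarrow>terminals m t. (1/2) ^ l * sup_norm (restr E (coord x)))
     \<le> (1/2) ^ m * tsirelson_norm (restr (node_set t) (coord x))"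
proof (induction t arbitrary: m)
  case (Node E ts)
  let ?f = "\<lambda>(l, E). (1/2) ^ l * sup_norm (restr E (coord x))"
  have E: "restr E (coord x) \<in> c00" using Node.prems by (intro restr_coord_c00) simp
  show ?case
  proof (cases "ts = []")
    case True
    then show ?thesis by (simp add: sup_norm_le_tn[OF E])
  next
    case False
    then have a: "admissible 1 (map node_set ts)" and U: "\<Union>(set (map node_set ts)) = E"
      using Node.prems by simp_all
    have "sum_list (map ?f (terminals m (Node E ts)))
        = (\<Sum>t\<leftarrow>ts. sum_list (map ?f (terminals (Suc m) t)))"
    proof -
      have "sum_list (map ?f (concat xs)) = (\<Sum>x\<leftarrow>xs. sum_list (map ?f x))" for xs
        by (induction xs) auto
      then show ?thesis using False by (simp add: comp_def)
    qed
    also have "\<dots> \<le> (\<Sum>t\<leftarrow>ts. (1/2) ^ Suc m * tsirelson_norm (restr (node_set t) (coord x)))"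
      by (rule sum_list_mono, rule Node.IH) (use Node.prems in auto)
    also have "\<dots> = (\<Sum>t\<leftarrow>ts. (1/2) ^ Suc m *
        tsirelson_norm (restr (node_set t) (restr E (coord x))))"
    proof -
      have "restr (node_set t) (restr E (coord x)) = restr (node_set t) (coord x)" if "t \<in> set ts" for t
      proof -
        have "node_set t \<inter> E = node_set t" using U that by auto
        then show ?thesis by (simp add: restr_restr)
      qed
      then show ?thesis by (metis (mono_tags, lifting) map_eq_conv)
    qed
    also have "\<dots> = (1/2) ^ m *
        (1/2 * (\<Sum>E'\<leftarrow>map node_set ts. tsirelson_norm (restr E' (restr E (coord x)))))"
      by (simp only: sum_list_const_mult map_map comp_def power_Suc mult_ac)
    also have "\<dots> \<le> (1/2) ^ m * tsirelson_norm (restr E (coord x))"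
      by (rule mult_left_mono[OF tn_half_sum[OF E a]]) simp
    finally show ?thesis by simp
  qed
qed

text \<open>Hence the supremum in \<^const>\<open>tree_norm\<close> is that of a bounded set.\<close>

lemma tree_sum_le_norm:
  assumes "admissible_tree t"
  shows "(\<Sum>(l, E)\<leftarrow>terminals 0 t. (1/2) ^ l * sup_norm (restr E (coord x))) \<le> norm x"
proof -
  have "finite (node_set t)" using assms by (cases t) simp
  then show ?thesis
    using tree_sum_le[OF assms, where m = 0 and x = x] tn_restr_le_norm[of "node_set t" x] by simp
qed


section \<open>Stability\<close>

definition stabilization_constant :: "real \<Rightarrow> bool" where
  "stabilization_constant K \<longleftrightarrow>
     (\<forall>Y. \<forall>n\<ge>1. block_subspace Y \<longrightarrow>
        (\<exists>Z d. block_subspace_of Z Y \<and> 0 < d \<and>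
           (\<forall>j<n. \<forall>z\<in>unit_sphere Z. d \<le> tree_norm j n z \<and> tree_norm j n z \<le> K * d)))"

definition stable_at :: "real \<Rightarrow> nat \<Rightarrow> real \<Rightarrow> tsirelson set \<Rightarrow> bool" where
  "stable_at K n d Z \<longleftrightarrow>
     d = (INF j\<in>{0..<n}. INF z\<in>unit_sphere Z. tree_norm j n z) \<and>
     (INF j\<in>{0..<n}. INF z\<in>unit_sphere Z. tree_norm j n z)
       \<le> (SUP j\<in>{0..<n}. SUP z\<in>unit_sphere Z. tree_norm j n z) \<and>
     (SUP j\<in>{0..<n}. SUP z\<in>unit_sphere Z. tree_norm j n z) \<le> K * d"

end

theory Submission
  imports Defs
begin

text \<open>
  Splitting a norming tree of \<open>z\<close> according to the levels of its terminal sets modulo \<open>n\<close> gives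
  \<open>\<parallel>z\<parallel> \<le> \<Sum>j<n. |z|\<^sub>j\<^sup>n\<close>, hence the lower bound.

  For the upper bound, every \<open>z\<close> supported in \<open>[2n + 2, \<infinity>)\<close> satisfies \<open>\<Sum>j<n. |z|\<^sub>j\<^sup>n \<le> 32 \<parallel>z\<parallel>\<close>,
  and any block subspace contains such \<open>z\<close>.  Indeed superpose \<open>n\<close> trees, one for each residue \<open>j\<close>.
  Consider a node \<open>F\<close> of their common refinement, with \<open>q = min F\<close>.  On \<open>F \<inter> [q, q\<^sup>2]\<close> the Tsirelson norm
  dominates a quarter of the \<open>l\<^sub>1\<close> norm, and the weights that the trees give to one coordinate are
  distinct powers of \<open>1/2\<close>, so that part is harmless.  On the rest of \<open>F\<close> the trees together cut
  at most \<open>nq\<close> times.  If each resulting piece is again divided into the part up to the square of its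
  minimum and the part beyond, there are at most \<open>2(nq + 1) \<le> q\<^sup>2\<close> sets beyond \<open>q\<^sup>2\<close>, an admissible
  family, and the estimate passes from the pieces to \<open>F\<close> without loss.
\<close>

section \<open>Lower estimates for the Tsirelson norm\<close>

lemma schreier_1_card:
  assumes "S \<in> schreier 1" "s \<in> S"
  shows "card S \<le> s"
proof -
  obtain l E where S: "S = (\<Union>p\<in>{1..l}. E p)"
    and E: "\<And>p. p \<in> {1..l} \<Longrightarrow> E p \<in> schreier 0 \<and> set_le {l} (E p)"
    using assms(1) unfolding One_nat_def schreier.simps by blast
  have sub: "E p = {} \<or> (\<exists>i. E p = {i})" if "p \<in> {1..l}" for p
    using E[OF that] by auto
  have "card S \<le> (\<Sum>p\<in>{1..l}. card (E p))"
    unfolding S by (rule card_UN_le) simp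
  also have "\<dots> \<le> (\<Sum>p\<in>{1..l}. 1)"
    by (rule sum_mono) (use sub in force)
  finally have "card S \<le> l" by simp
  moreover obtain p where p: "p \<in> {1..l}" "s \<in> E p" using assms(2) S by blast
  then have "E p = {s}" using sub[OF p(1)] by auto
  then have "l \<le> s" using E[OF p(1)] by (simp add: set_le_def)
  ultimately show ?thesis by linarith
qed

lemma schreier_1I:
  assumes "finite S" "\<And>s. s \<in> S \<Longrightarrow> card S \<le> s"
  shows "S \<in> schreier 1"
proof (cases "S = {}")
  case True
  then show ?thesis by (simp only: schreier_empty)
next
  case False
  define xs where "xs = sorted_list_of_set S"
  have xs: "set xs = S" "sorted_wrt (<) xs" "length xs = card S"
    using assms(1) by (simp_all add: xs_def)
  have pos: "1 \<le> card S" using False assms(1) by (simp add: Suc_le_eq card_gt_0_iff)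
  have idx: "xs ! (p - 1) \<in> S" if "p \<in> {1..card S}" for p
  proof -
    have "p - 1 < length xs" using that pos xs(3) by auto
    then show ?thesis using xs(1) nth_mem by blast
  qed
  have U: "S = (\<Union>p\<in>{1..card S}. {xs ! (p - 1)})"
  proof (intro antisym subsetI)
    fix s assume "s \<in> S"
    then obtain i where i: "i < card S" "xs ! i = s" using xs by (metis in_set_conv_nth)
    show "s \<in> (\<Union>p\<in>{1..card S}. {xs ! (p - 1)})"
      by (rule UN_I[of "Suc i"]) (use i in auto)
  qed (use idx in auto)
  have "(\<forall>p\<in>{1..card S}. {xs ! (p - 1)} \<in> schreier 0 \<and> set_le {card S} {xs ! (p - 1)})"
    using idx assms(2) pos by (force simp: set_le_def)
  moreover have "\<forall>p\<in>{1..card S}. \<forall>q\<in>{1..card S}. p < q \<longrightarrow>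
      set_less {xs ! (p - 1)} {xs ! (q - 1)}"
  proof (intro ballI impI)
    fix p q assume "p \<in> {1..card S}" "q \<in> {1..card S}" "p < q"
    then have "xs ! (p - 1) < xs ! (q - 1)"
      using xs(3) by (intro sorted_wrt_nth_less[OF xs(2)]) auto
    then show "set_less {xs ! (p - 1)} {xs ! (q - 1)}" by (simp add: set_less_def)
  qed
  ultimately show ?thesis using U pos unfolding One_nat_def schreier.simps by blast
qed

lemma set_less_iff:
  assumes "finite E" "E \<noteq> {}" "finite F" "F \<noteq> {}"
  shows "set_less E F \<longleftrightarrow> (\<forall>i\<in>E. \<forall>k\<in>F. i < k)"
  using assms by (auto simp: set_less_def)

lemma admissible_1_length_le:
  assumes "admissible 1 Es" "E \<in> set Es" "i \<in> E"
  shows "length Es \<le> i"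
proof -
  have Es: "\<forall>E\<in>set Es. finite E \<and> E \<noteq> {}" "sorted_wrt set_less Es" "Min ` set Es \<in> schreier 1"
    using assms(1) by (auto simp: admissible_def)
  have "sorted_wrt (<) (map Min Es)"
    unfolding sorted_wrt_map
  proof (rule sorted_wrt_mono_rel[OF _ Es(2)])
    fix E F assume "E \<in> set Es" "F \<in> set Es" "set_less E F"
    then show "Min E < Min F"
      using Es(1) set_less_iff[of E F] by auto
  qed
  then have "distinct (map Min Es)" by (simp only: strict_sorted_iff)
  then have "length Es = card (Min ` set Es)"
    using distinct_card[of "map Min Es"] by simp
  also have "\<dots> \<le> Min E" by (rule schreier_1_card[OF Es(3)]) (use assms(2) in auto)
  also have "Min E \<le> i" using assms(2,3) Es(1) by (intro Min_le) auto
  finally show ?thesis .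
qed

lemma admissible_1I:
  assumes "\<And>E. E \<in> set Es \<Longrightarrow> finite E \<and> E \<noteq> {} \<and> 0 \<notin> E" "sorted_wrt set_less Es"
    "\<And>E i. E \<in> set Es \<Longrightarrow> i \<in> E \<Longrightarrow> length Es \<le> i"
  shows "admissible 1 Es"
proof -
  have "card (Min ` set Es) \<le> length Es"
    using card_image_le[of "set Es" Min] card_length[of Es] by simp
  then have "Min ` set Es \<in> schreier 1"
    by (intro schreier_1I) (use assms(1,3) in \<open>fastforce intro: order_trans\<close>)+
  then show ?thesis using assms by (simp add: admissible_def)
qed

lemma tn_mono_label:
  fixes f :: "nat \<Rightarrow> nat"
  assumes H: "finite H" and x0: "x 0 = 0" and f: "mono_on H f"
    and le: "\<And>i. i \<in> H \<Longrightarrow> card (f ` H) \<le> i"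
  shows "(\<Sum>c\<in>f ` H. tsirelson_norm (restr {i \<in> H. f i = c} x)) \<le> 2 * tsirelson_norm (restr H x)"
proof -
  define cs where "cs = sorted_list_of_set (f ` H)"
  define piece where "piece = (\<lambda>c. {i \<in> H. f i = c})"
  have cs: "set cs = f ` H" "sorted_wrt (<) cs" "length cs = card (f ` H)" "distinct cs"
    using H by (simp_all add: cs_def)
  have "0 \<notin> H"
  proof
    assume "0 \<in> H"
    then have "f ` H = {}" using le H by fastforce
    then show False using \<open>0 \<in> H\<close> by auto
  qed
  have "admissible 1 (map piece cs)"
  proof (rule admissible_1I)
    fix E assume "E \<in> set (map piece cs)"
    then show "finite E \<and> E \<noteq> {} \<and> 0 \<notin> E" "\<And>i. i \<in> E \<Longrightarrow> length (map piece cs) \<le> i"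
      using H \<open>0 \<notin> H\<close> le cs by (auto simp: piece_def)
  next
    show "sorted_wrt set_less (map piece cs)"
      unfolding sorted_wrt_map
    proof (rule sorted_wrt_mono_rel[OF _ cs(2)])
      fix c d assume cd: "c \<in> set cs" "d \<in> set cs" "c < d"
      have "i < k" if "i \<in> piece c" "k \<in> piece d" for i k
      proof (rule ccontr)
        assume "\<not> i < k"
        then have "f k \<le> f i" using that by (intro mono_onD[OF f]) (auto simp: piece_def)
        then show False using that cd by (simp add: piece_def)
      qed
      moreover have "finite (piece c)" "finite (piece d)" "piece c \<noteq> {}" "piece d \<noteq> {}"
        using cd cs(1) H by (auto simp: piece_def)
      ultimately show "set_less (piece c) (piece d)" by (simp add: set_less_iff)
    qed
  qed
  from tn_half_sum[OF c00_restr_finite[of x, OF x0 H] this]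
  have "(\<Sum>c\<leftarrow>cs. tsirelson_norm (restr (piece c) (restr H x))) \<le> 2 * tsirelson_norm (restr H x)"
    by (simp add: comp_def)
  moreover have "piece c \<inter> H = piece c" for c by (auto simp: piece_def)
  ultimately show ?thesis
    using cs by (simp add: restr_restr sum_list_distinct_conv_sum_set piece_def)
qed

lemma tn_mono_label_split:
  fixes c b :: "nat \<Rightarrow> nat"
  assumes H: "finite H" and x0: "x 0 = 0" and c: "mono_on H c"
    and le: "\<And>i. i \<in> H \<Longrightarrow> 2 * card (c ` H) \<le> i"
  shows "(\<Sum>a\<in>c ` H. tsirelson_norm (restr ({i \<in> H. c i = a} \<inter> {..b a}) x) +
      tsirelson_norm (restr ({i \<in> H. c i = a} \<inter> {b a<..}) x)) \<le> 2 * tsirelson_norm (restr H x)"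
proof -
  define e where "e = (\<lambda>i. if i \<le> b (c i) then 0 else 1 :: nat)"
  define f where "f = (\<lambda>i. 2 * c i + e i)"
  define t where "t = (\<lambda>a. tsirelson_norm (restr {i \<in> H. f i = a} x))"
  have f_iff: "f i = 2 * a + k \<longleftrightarrow> c i = a \<and> e i = k" if "k < 2" for i a k
  proof -
    have "e i < 2" by (simp add: e_def)
    then show ?thesis using that unfolding f_def by presburger
  qed
  have "t (2 * a) = tsirelson_norm (restr ({i \<in> H. c i = a} \<inter> {..b a}) x)" for a
  proof -
    have "{i \<in> H. f i = 2 * a} = {i \<in> H. c i = a} \<inter> {..b a}"
      using f_iff[of 0 _ a] by (auto simp: e_def split: if_splits)
    then show ?thesis by (simp only: t_def)
  qed
  moreover have "t (2 * a + 1) = tsirelson_norm (restr ({i \<in> H. c i = a} \<inter> {b a<..}) x)" for a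
  proof -
    have "{i \<in> H. f i = 2 * a + 1} = {i \<in> H. c i = a} \<inter> {b a<..}"
      using f_iff[of 1 _ a] by (auto simp: e_def split: if_splits)
    then show ?thesis by (simp only: t_def)
  qed
  ultimately have "(\<Sum>a\<in>c ` H. tsirelson_norm (restr ({i \<in> H. c i = a} \<inter> {..b a}) x) +
      tsirelson_norm (restr ({i \<in> H. c i = a} \<inter> {b a<..}) x))
      = (\<Sum>a\<in>c ` H. t (2 * a)) + (\<Sum>a\<in>c ` H. t (2 * a + 1))"
    by (simp only: sum.distrib)
  also have "(\<Sum>a\<in>c ` H. t (2 * a)) = sum t ((\<lambda>a. 2 * a) ` (c ` H))"
    by (subst sum.reindex) (auto simp: inj_on_def)
  also have "(\<Sum>a\<in>c ` H. t (2 * a + 1)) = sum t ((\<lambda>a. 2 * a + 1) ` (c ` H))"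
    by (subst sum.reindex) (auto simp: inj_on_def)
  also have "sum t ((\<lambda>a. 2 * a) ` (c ` H)) + sum t ((\<lambda>a. 2 * a + 1) ` (c ` H))
      = sum t ((\<lambda>a. 2 * a) ` (c ` H) \<union> (\<lambda>a. 2 * a + 1) ` (c ` H))"
  proof (rule sum.union_disjoint[symmetric])
    have "2 * a \<noteq> 2 * a' + 1" for a a' :: nat by presburger
    then show "(\<lambda>a. 2 * a) ` (c ` H) \<inter> (\<lambda>a. 2 * a + 1) ` (c ` H) = {}" by blast
  qed (use H in auto)
  also have "\<dots> = sum t (f ` H)"
  proof (rule sum.mono_neutral_right)
    show "f ` H \<subseteq> (\<lambda>a. 2 * a) ` (c ` H) \<union> (\<lambda>a. 2 * a + 1) ` (c ` H)"
      by (auto simp: f_def e_def)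
    have "t a = 0" if "a \<notin> f ` H" for a
    proof -
      have "{i \<in> H. f i = a} = {}" using that by blast
      then have "t a = tsirelson_norm (restr {} x)" by (simp only: t_def)
      then show ?thesis by (simp add: restr_def tn_zero)
    qed
    then show "\<forall>a\<in>(\<lambda>a. 2 * a) ` (c ` H) \<union> (\<lambda>a. 2 * a + 1) ` (c ` H) - f ` H. t a = 0" by blast
  qed (use H in auto)
  also have "\<dots> \<le> 2 * tsirelson_norm (restr H x)"
    unfolding t_def
  proof (rule tn_mono_label)
    show "finite H" "x 0 = 0" by (fact H x0)+
    show "mono_on H f"
    proof (rule mono_onI)
      fix i k assume ik: "i \<in> H" "k \<in> H" "i \<le> k"
      have "c i \<le> c k" using mono_onD[OF c] ik by blast
      then show "f i \<le> f k"
        using ik(3) by (cases "c i = c k") (auto simp: f_def e_def)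
    qed
    fix i assume i: "i \<in> H"
    have "f ` H \<subseteq> (\<lambda>(a, k). 2 * a + k) ` (c ` H \<times> {0, 1})"
      by (auto simp: f_def e_def image_iff)
    then have "card (f ` H) \<le> card (c ` H \<times> {0, 1 :: nat})"
      by (rule surj_card_le[rotated]) (use H in auto)
    also have "\<dots> = 2 * card (c ` H)" by (simp add: card_cartesian_product)
    finally show "card (f ` H) \<le> i" using le[OF i] by linarith
  qed
  finally show ?thesis .
qed

lemma abs_le_tn_restr:
  assumes "x 0 = 0" "finite H" "i \<in> H" shows "\<bar>x i\<bar> \<le> tsirelson_norm (restr H x)"
proof -
  have c: "restr H x \<in> c00" using assms by (intro c00_restr_finite)
  have "\<bar>x i\<bar> = \<bar>restr H x i\<bar>" using assms by (simp add: restr_def)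
  also have "\<dots> \<le> tsirelson_norm (restr H x)"
    using abs_le_sup_norm[OF c] sup_norm_le_tn[OF c] order_trans by blast
  finally show ?thesis .
qed

lemma sum_abs_le_tn:
  assumes H: "finite H" and x0: "x 0 = 0" and le: "\<And>i. i \<in> H \<Longrightarrow> card H \<le> i"
  shows "(\<Sum>i\<in>H. \<bar>x i\<bar>) \<le> 2 * tsirelson_norm (restr H x)"
proof -
  have "(\<Sum>i\<in>H. \<bar>x i\<bar>) \<le> (\<Sum>c\<in>(\<lambda>i. i) ` H. tsirelson_norm (restr {i \<in> H. i = c} x))"
    by (simp, rule sum_mono, rule abs_le_tn_restr) (use x0 H in auto)
  also have "\<dots> \<le> 2 * tsirelson_norm (restr H x)"
    by (rule tn_mono_label) (use assms in \<open>auto intro!: mono_onI\<close>)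
  finally show ?thesis .
qed

lemma sum_abs_le_tn_square:
  fixes q :: nat
  assumes H: "H \<subseteq> {q..q\<^sup>2}" and q: "1 \<le> q" and x0: "x 0 = 0"
  shows "(\<Sum>i\<in>H. \<bar>x i\<bar>) \<le> 4 * tsirelson_norm (restr H x)"
proof -
  have fin: "finite H" using H finite_subset by blast
  let ?f = "\<lambda>i. i div q"
  have img: "?f ` H \<subseteq> {1..q}"
  proof safe
    fix i assume "i \<in> H"
    then have "q \<le> i" "i \<le> q\<^sup>2" using H by auto
    then have "q div q \<le> i div q" "i div q \<le> q\<^sup>2 div q" by (auto intro: div_le_mono)
    then show "i div q \<in> {1..q}" using q by (simp add: power2_eq_square)
  qed
  have "(\<Sum>i\<in>H. \<bar>x i\<bar>) = (\<Sum>c\<in>?f ` H. \<Sum>i | i \<in> H \<and> ?f i = c. \<bar>x i\<bar>)"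
    by (rule sum.group[symmetric]) (use fin in auto)
  also have "\<dots> \<le> (\<Sum>c\<in>?f ` H. 2 * tsirelson_norm (restr {i \<in> H. ?f i = c} x))"
  proof (rule sum_mono, rule sum_abs_le_tn)
    fix c i assume i: "i \<in> {i \<in> H. ?f i = c}"
    have "{i \<in> H. ?f i = c} \<subseteq> {c * q..<c * q + q}"
      using q by (auto simp: dividend_less_div_times add.commute)
    then have "card {i \<in> H. ?f i = c} \<le> q"
      using card_mono[of "{c * q..<c * q + q}"] by fastforce
    then show "card {i \<in> H. ?f i = c} \<le> i" using i H by fastforce
  qed (use fin x0 in auto)
  also have "\<dots> \<le> 2 * (2 * tsirelson_norm (restr H x))"
    unfolding sum_distrib_left[symmetric]
  proof (intro mult_left_mono tn_mono_label)
    fix i assume "i \<in> H"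
    then show "card (?f ` H) \<le> i" using H card_mono[OF _ img] by fastforce
  qed (use fin x0 in \<open>auto intro!: mono_onI div_le_mono\<close>)
  finally show ?thesis by simp
qed

section \<open>Superposition of trees\<close>

text \<open>
  \<open>g\<close> is the coefficient sequence of the functional of a subtree whose root has level \<open>m\<close> and whose
  terminal levels lie in \<open>A\<close>.  The starting point \<open>s\<close> of the root only bounds the number of children;
  it is not tied to the support of \<open>g\<close>, so a bare root can be put below any tree.
\<close>

inductive tree_weight :: "nat set \<Rightarrow> nat \<Rightarrow> nat \<Rightarrow> (nat \<Rightarrow> real) \<Rightarrow> bool" for A where
  leaf: "m \<in> A \<Longrightarrow> tree_weight A m s (\<lambda>i. if i = s then (1/2) ^ m else 0)"
| branch: "k \<le> s \<Longrightarrow> (\<And>p. p < k \<Longrightarrow> tree_weight A (Suc m) (u p) (h p)) \<Longrightarrow>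
    (\<And>p i. p < k \<Longrightarrow> h p i \<noteq> 0 \<Longrightarrow> u p \<le> i) \<Longrightarrow>
    (\<And>p r i. p < r \<Longrightarrow> r < k \<Longrightarrow> h p i \<noteq> 0 \<Longrightarrow> i < u r) \<Longrightarrow>
    tree_weight A m s (\<lambda>i. \<Sum>p<k. h p i)"

lemma sum_eq_single:
  fixes h :: "'a \<Rightarrow> 'b::comm_monoid_add"
  assumes "finite S" "p \<in> S" "\<And>r. r \<in> S \<Longrightarrow> r \<noteq> p \<Longrightarrow> h r = 0"
  shows "(\<Sum>r\<in>S. h r) = h p"
  using assms by (subst sum.remove[of S p]) auto

lemma tree_weight_values:
  "tree_weight A m s g \<Longrightarrow> g i = 0 \<or> (\<exists>l\<in>A. m \<le> l \<and> g i = (1/2) ^ l)"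
proof (induction rule: tree_weight.induct)
  case (branch k s m u h)
  show ?case
  proof (cases "\<exists>p<k. h p i \<noteq> 0")
    case True
    then obtain p where p: "p < k" "h p i \<noteq> 0" by blast
    have "h r i = 0" if "r < k" "r \<noteq> p" for r
      using branch(3,4) p that by (meson linorder_neqE_nat not_less)
    then have "(\<Sum>r<k. h r i) = h p i"
      using p by (intro sum_eq_single[where h="\<lambda>r. h r i"]) auto
    then show ?thesis using branch.IH[OF p(1)] p(2) Suc_leD by metis
  next
    case False
    then show ?thesis by (intro disjI1 sum.neutral) auto
  qed
qed auto

lemma geometric_tail_le:
  assumes "finite S" "\<And>l. l \<in> S \<Longrightarrow> m \<le> l"
  shows "(\<Sum>l\<in>S. (1/2) ^ l) \<le> 2 * (1/2 :: real) ^ m"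
proof -
  obtain N where "\<forall>l\<in>S. l \<le> N" using assms(1) finite_nat_set_iff_bounded_le by blast
  then have sub: "S \<subseteq> {m..<m + Suc N}" using assms(2) by fastforce
  have e: "(\<Sum>l\<in>{m..<m + k}. (1/2 :: real) ^ l) = 2 * (1/2) ^ m - 2 * (1/2) ^ (m + k)" for k
    by (induction k) auto
  have "(\<Sum>l\<in>S. (1/2 :: real) ^ l) \<le> (\<Sum>l\<in>{m..<m + Suc N}. (1/2) ^ l)"
    by (rule sum_mono2) (use sub in auto)
  also have "\<dots> \<le> 2 * (1/2) ^ m" unfolding e by simp
  finally show ?thesis .
qed

lemma sum_tree_weight_le:
  assumes J: "finite J" and A: "disjoint_family_on A J"
    and g: "\<And>j. j \<in> J \<Longrightarrow> tree_weight (A j) m (s j) (g j)"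
  shows "(\<Sum>j\<in>J. g j i) \<le> 2 * (1/2) ^ m"
proof -
  define J' where "J' = {j \<in> J. g j i \<noteq> 0}"
  have "\<forall>j\<in>J'. \<exists>l. l \<in> A j \<and> m \<le> l \<and> g j i = (1/2) ^ l"
    using tree_weight_values[OF g] by (fastforce simp: J'_def)
  then obtain l where l: "\<And>j. j \<in> J' \<Longrightarrow> l j \<in> A j \<and> m \<le> l j \<and> g j i = (1/2) ^ l j"
    by metis
  have inj: "inj_on l J'"
  proof (rule inj_onI, rule ccontr)
    fix a b assume ab: "a \<in> J'" "b \<in> J'" "l a = l b" "a \<noteq> b"
    then have "A a \<inter> A b = {}" using A by (auto simp: J'_def disjoint_family_on_def)
    then show False using l ab by (metis IntI empty_iff)
  qed
  have "(\<Sum>j\<in>J. g j i) = (\<Sum>j\<in>J'. g j i)"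
    by (rule sum.mono_neutral_right) (use J in \<open>auto simp: J'_def\<close>)
  also have "\<dots> = (\<Sum>j\<in>J'. (1/2) ^ l j)" by (rule sum.cong[OF refl]) (use l in blast)
  also have "\<dots> = (\<Sum>k\<in>l ` J'. (1/2) ^ k)" using inj by (simp add: sum.reindex)
  also have "\<dots> \<le> 2 * (1/2) ^ m"
  proof (rule geometric_tail_le)
    show "finite (l ` J')" using J by (simp add: J'_def)
    show "m \<le> k" if "k \<in> l ` J'" for k using l that by blast
  qed
  finally show ?thesis .
qed

definition uncut :: "nat set \<Rightarrow> nat set \<Rightarrow> bool" where
  "uncut P R \<longleftrightarrow> (\<forall>p\<in>P. \<forall>i\<in>R. \<forall>k\<in>R. i < p \<longrightarrow> k < p)"

definition descends :: "nat set \<Rightarrow> nat \<Rightarrow> (nat \<Rightarrow> real) \<Rightarrow> nat set \<Rightarrow> bool" where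
  "descends A m g R \<longleftrightarrow> (\<forall>i\<in>R. g i = 0) \<or>
     (\<exists>s' g'. tree_weight A m s' g' \<and> s' \<le> Min R \<and> (\<forall>i\<in>R. g i = g' i))"

text \<open>
  It suffices to cut at the starting points of the children: then every piece meets at most one of
  them, and that one does not start inside the piece.
\<close>

lemma tree_weight_descends:
  assumes "tree_weight A m s g" "s \<le> q"
  shows "\<exists>P. finite P \<and> card P \<le> q \<and>
    (\<forall>R. R \<noteq> {} \<longrightarrow> finite R \<longrightarrow> (\<forall>i\<in>R. q < i) \<longrightarrow> uncut P R \<longrightarrow> descends A (Suc m) g R)"
  using assms(1)
proof cases
  case leaf
  show ?thesis by (rule exI[of _ "{}"]) (use leaf assms(2) in \<open>auto simp: descends_def\<close>)
next
  case (branch k u h)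
  show ?thesis
  proof (intro exI[of _ "u ` {..<k}"] conjI allI impI)
    show "card (u ` {..<k}) \<le> q"
      using card_image_le[of "{..<k}" u] branch(2) assms(2) by simp
  next
    fix R assume R: "R \<noteq> {}" "finite R" and "uncut (u ` {..<k}) R"
    then have cut: "k' < p" if "p \<in> u ` {..<k}" "i \<in> R" "k' \<in> R" "i < p" for p i k'
      using that unfolding uncut_def by blast
    show "descends A (Suc m) g R"
    proof (cases "\<exists>p<k. \<exists>i\<in>R. h p i \<noteq> 0")
      case False
      then show ?thesis unfolding descends_def using branch(1) by (intro disjI1) (auto intro!: sum.neutral)
    next
      case True
      then obtain p i where p: "p < k" "i \<in> R" "h p i \<noteq> 0" by blast
      have other: "h r i' = 0" if r: "r < k" "r \<noteq> p" and i': "i' \<in> R" for r i'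
      proof (rule ccontr)
        assume h: "h r i' \<noteq> 0"
        consider "r < p" | "p < r" using r(2) by linarith
        then show False
        proof cases
          case 1
          then have "i' < u p" "u p \<le> i" using branch(4,5) h p by blast+
          moreover from this have "i < u p" using cut[of "u p" i' i] i' p by auto
          ultimately show False by simp
        next
          case 2
          then have "i < u r" "u r \<le> i'" using branch(4,5) h p r by blast+
          moreover from this have "i' < u r" using cut[of "u r" i i'] i' p r by auto
          ultimately show False by simp
        qed
      qed
      have "g i' = h p i'" if "i' \<in> R" for i'
        unfolding branch(1) using p(1) other that
        by (intro sum_eq_single[where h="\<lambda>r. h r i'"]) auto
      moreover have "u p \<le> Min R"
      proof (rule ccontr)
        assume "\<not> u p \<le> Min R"
        then have "Min R < u p" by linarith
        moreover have "Min R \<in> R" using R by simp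
        ultimately have "i < u p" using cut p(1,2) by blast
        then show False using branch(4) p by fastforce
      qed
      ultimately show ?thesis unfolding descends_def using branch(3) p(1) by blast
    qed
  qed simp
qed

lemma superposition:
  assumes n: "finite F" "F \<noteq> {}" "2 * n + 2 \<le> Min F"
    and J: "finite J" "card J \<le> n" and A: "disjoint_family_on A J" and x0: "x 0 = 0"
    and g: "\<And>j. j \<in> J \<Longrightarrow> tree_weight (A j) m (s j) (g j)" "\<And>j. j \<in> J \<Longrightarrow> s j \<le> Min F"
  shows "(\<Sum>i\<in>F. (\<Sum>j\<in>J. g j i) * \<bar>x i\<bar>) \<le> 8 * (1/2) ^ m *
    (tsirelson_norm (restr (F \<inter> {..(Min F)\<^sup>2}) x) + tsirelson_norm (restr (F \<inter> {(Min F)\<^sup>2<..}) x))"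
  using n J A g
proof (induction "card F" arbitrary: F J m s g rule: less_induct)
  case less
  note F = less.prems(1-3) and J = less.prems(4,5) and A = less.prems(6) and g = less.prems(7,8)
  define q where "q = Min F"
  define I where "I = F \<inter> {..q\<^sup>2}"
  define R where "R = F \<inter> {q\<^sup>2<..}"
  have qF: "q \<in> F" "\<And>i. i \<in> F \<Longrightarrow> q \<le> i" using F by (auto simp: q_def)
  have q: "2 * n + 2 \<le> q" using F by (simp add: q_def)
  have qq: "q \<le> q\<^sup>2" by (simp add: power2_eq_square)
  have IR: "I \<union> R = F" "I \<inter> R = {}" by (auto simp: I_def R_def)
  have fin: "finite I" "finite R" using F by (auto simp: I_def R_def)
  define G where "G = (\<lambda>i. \<Sum>j\<in>J. g j i)"
  have "(\<Sum>i\<in>I. G i * \<bar>x i\<bar>) \<le> (\<Sum>i\<in>I. 2 * (1/2) ^ m * \<bar>x i\<bar>)"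
    unfolding G_def by (intro sum_mono mult_right_mono sum_tree_weight_le[OF J(1) A g(1)]) auto
  also have "\<dots> = 2 * (1/2) ^ m * (\<Sum>i\<in>I. \<bar>x i\<bar>)" by (simp add: sum_distrib_left)
  also have "\<dots> \<le> 2 * (1/2) ^ m * (4 * tsirelson_norm (restr I x))"
    by (intro mult_left_mono sum_abs_le_tn_square[of I q] x0) (use q qF in \<open>auto simp: I_def\<close>)
  finally have I: "(\<Sum>i\<in>I. G i * \<bar>x i\<bar>) \<le> 8 * (1/2) ^ m * tsirelson_norm (restr I x)" by simp
  have R: "(\<Sum>i\<in>R. G i * \<bar>x i\<bar>) \<le> 8 * (1/2) ^ m * tsirelson_norm (restr R x)"
  proof -
    have "\<exists>P. finite P \<and> card P \<le> q \<and> (\<forall>R. R \<noteq> {} \<longrightarrow> finite R \<longrightarrow> (\<forall>i\<in>R. q < i) \<longrightarrow>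
      uncut P R \<longrightarrow> descends (A j) (Suc m) (g j) R)" if "j \<in> J" for j
      by (rule tree_weight_descends[OF g(1)[OF that]]) (use g(2)[OF that] in \<open>simp add: q_def\<close>)
    then obtain P where P: "\<And>j. j \<in> J \<Longrightarrow> finite (P j) \<and> card (P j) \<le> q"
      and descends: "\<And>j R. j \<in> J \<Longrightarrow> R \<noteq> {} \<Longrightarrow> finite R \<Longrightarrow> \<forall>i\<in>R. q < i \<Longrightarrow>
        uncut (P j) R \<Longrightarrow> descends (A j) (Suc m) (g j) R"
      by metis
    define Q where "Q = (\<Union>j\<in>J. P j)"
    have finQ: "finite Q" using P J by (auto simp: Q_def)
    have "card Q \<le> (\<Sum>j\<in>J. card (P j))" unfolding Q_def by (rule card_UN_le[OF J(1)])
    also have "\<dots> \<le> (\<Sum>j\<in>J. q)" using P by (intro sum_mono) auto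
    also have "\<dots> \<le> n * q" using J by simp
    finally have cardQ: "card Q \<le> n * q" .
    define c where "c = (\<lambda>i. card {p \<in> Q. p \<le> i})"
    define piece where "piece = (\<lambda>a. {i \<in> R. c i = a})"
    have c_mono: "c i \<le> c k" if "i \<le> k" for i k
      unfolding c_def by (rule card_mono) (use finQ that in auto)
    have c_cut: "k < p" if "p \<in> Q" "c i = c k" "i < p" for i k p
    proof (rule ccontr)
      assume "\<not> k < p"
      then have "{r \<in> Q. r \<le> i} \<subset> {r \<in> Q. r \<le> k}" using that by force
      then have "c i < c k" unfolding c_def by (rule psubset_card_mono[rotated]) (use finQ in auto)
      then show False using that by simp
    qed
    have c_le: "c i \<le> n * q" for i
      unfolding c_def using card_mono[OF finQ, of "{p \<in> Q. p \<le> i}"] cardQ by fastforce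
    have piece: "(\<Sum>i\<in>piece a. G i * \<bar>x i\<bar>) \<le> 8 * (1/2) ^ Suc m *
        (tsirelson_norm (restr (piece a \<inter> {..(Min (piece a))\<^sup>2}) x) +
         tsirelson_norm (restr (piece a \<inter> {(Min (piece a))\<^sup>2<..}) x))" if a: "a \<in> c ` R" for a
    proof -
      have pc: "piece a \<noteq> {}" "finite (piece a)" "\<forall>i\<in>piece a. q < i"
        using a F(1) qq by (auto simp: piece_def R_def)
      define J' where "J' = {j \<in> J. \<not> (\<forall>i\<in>piece a. g j i = 0)}"
      have "\<exists>s' g'. tree_weight (A j) (Suc m) s' g' \<and> s' \<le> Min (piece a) \<and>
          (\<forall>i\<in>piece a. g j i = g' i)" if j: "j \<in> J'" for j
      proof -
        have "uncut (P j) (piece a)"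
          unfolding uncut_def
        proof (intro ballI impI)
          fix p i k assume "p \<in> P j" "i \<in> piece a" "k \<in> piece a" "i < p"
          then show "k < p"
            using j by (intro c_cut[of p i k]) (auto simp: J'_def Q_def piece_def)
        qed
        then have "descends (A j) (Suc m) (g j) (piece a)"
          using descends[OF _ pc] j by (simp add: J'_def)
        then show ?thesis using j by (auto simp: descends_def J'_def)
      qed
      then obtain s' g' where g': "\<And>j. j \<in> J' \<Longrightarrow> tree_weight (A j) (Suc m) (s' j) (g' j)"
        "\<And>j. j \<in> J' \<Longrightarrow> s' j \<le> Min (piece a)"
        "\<And>j i. j \<in> J' \<Longrightarrow> i \<in> piece a \<Longrightarrow> g j i = g' j i" by metis
      have G': "G i = (\<Sum>j\<in>J'. g' j i)" if "i \<in> piece a" for i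
      proof -
        have "G i = (\<Sum>j\<in>J'. g j i)"
          unfolding G_def by (rule sum.mono_neutral_right) (use J that in \<open>auto simp: J'_def\<close>)
        then show ?thesis using g'(3) that by simp
      qed
      have "(\<Sum>i\<in>piece a. G i * \<bar>x i\<bar>) = (\<Sum>i\<in>piece a. (\<Sum>j\<in>J'. g' j i) * \<bar>x i\<bar>)"
        by (rule sum.cong[OF refl]) (simp only: G')
      also have "\<dots> \<le> 8 * (1/2) ^ Suc m *
        (tsirelson_norm (restr (piece a \<inter> {..(Min (piece a))\<^sup>2}) x) +
         tsirelson_norm (restr (piece a \<inter> {(Min (piece a))\<^sup>2<..}) x))"
      proof (rule less.hyps)
        have "q \<notin> piece a" using pc(3) by blast
        moreover have "piece a \<subseteq> F" by (auto simp: piece_def R_def)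
        ultimately have "piece a \<subset> F" using qF(1) by blast
        then show "card (piece a) < card F" by (rule psubset_card_mono[OF F(1)])
        have "q < Min (piece a)" using pc Min_in by blast
        then show "2 * n + 2 \<le> Min (piece a)" using q by linarith
        have "J' \<subseteq> J" by (auto simp: J'_def)
        then show "finite J'" by (rule finite_subset[OF _ J(1)])
        show "card J' \<le> n" using card_mono[OF J(1) \<open>J' \<subseteq> J\<close>] J(2) by (rule order_trans)
        show "disjoint_family_on A J'"
          by (rule disjoint_family_on_mono[OF \<open>J' \<subseteq> J\<close> A])
        show "finite (piece a)" "piece a \<noteq> {}" using pc by blast+
        fix j assume "j \<in> J'"
        then show "tree_weight (A j) (Suc m) (s' j) (g' j)" "s' j \<le> Min (piece a)"
          using g'(1,2) by blast+
      qed
      finally show ?thesis .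
    qed
    have "(\<Sum>i\<in>R. G i * \<bar>x i\<bar>) = (\<Sum>a\<in>c ` R. \<Sum>i\<in>piece a. G i * \<bar>x i\<bar>)"
      unfolding piece_def by (rule sum.group[symmetric]) (use fin in auto)
    also have "\<dots> \<le> (\<Sum>a\<in>c ` R. 8 * (1/2) ^ Suc m *
        (tsirelson_norm (restr (piece a \<inter> {..(Min (piece a))\<^sup>2}) x) +
         tsirelson_norm (restr (piece a \<inter> {(Min (piece a))\<^sup>2<..}) x)))"
      by (rule sum_mono[OF piece])
    also have "\<dots> = 8 * (1/2) ^ Suc m * (\<Sum>a\<in>c ` R.
        tsirelson_norm (restr (piece a \<inter> {..(Min (piece a))\<^sup>2}) x) +
         tsirelson_norm (restr (piece a \<inter> {(Min (piece a))\<^sup>2<..}) x))"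
      by (simp only: sum_distrib_left)
    also have "\<dots> \<le> 8 * (1/2) ^ Suc m * (2 * tsirelson_norm (restr R x))"
    proof (rule mult_left_mono)
      show "(\<Sum>a\<in>c ` R.
        tsirelson_norm (restr (piece a \<inter> {..(Min (piece a))\<^sup>2}) x) +
         tsirelson_norm (restr (piece a \<inter> {(Min (piece a))\<^sup>2<..}) x)) \<le> 2 * tsirelson_norm (restr R x)"
        unfolding piece_def
      proof (rule tn_mono_label_split[where b = "\<lambda>a. (Min {i \<in> R. c i = a})\<^sup>2"])
        show "mono_on R c" using c_mono by (intro mono_onI)
        fix i assume i: "i \<in> R"
        have "c ` R \<subseteq> {..n * q}" using c_le by blast
        then have "card (c ` R) \<le> n * q + 1" using card_mono[of "{..n * q}" "c ` R"] by simp
        then have "2 * card (c ` R) \<le> (2 * n + 2) * q" using q by (simp add: algebra_simps)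
        also have "\<dots> \<le> q\<^sup>2" unfolding power2_eq_square using q by (rule mult_right_mono) simp
        also have "q\<^sup>2 \<le> i" using i by (simp add: R_def)
        finally show "2 * card (c ` R) \<le> i" .
      qed (use fin x0 in auto)
    qed simp
    finally show ?thesis by simp
  qed
  have "(\<Sum>i\<in>F. G i * \<bar>x i\<bar>) = (\<Sum>i\<in>I. G i * \<bar>x i\<bar>) + (\<Sum>i\<in>R. G i * \<bar>x i\<bar>)"
    unfolding IR(1)[symmetric] by (rule sum.union_disjoint) (use fin IR in auto)
  also have "\<dots> \<le> 8 * (1/2) ^ m * (tsirelson_norm (restr I x) + tsirelson_norm (restr R x))"
    using I R by (simp add: distrib_left)
  finally show ?case by (simp add: G_def I_def R_def q_def)
qed


definition tree_sum :: "nat \<Rightarrow> set_tree \<Rightarrow> (nat \<Rightarrow> real) \<Rightarrow> real" where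
  "tree_sum m t x = (\<Sum>(l, E)\<leftarrow>terminals m t. (1/2) ^ l * sup_norm (restr E x))"

lemma tree_sum_leaf: "tree_sum m (Node E []) x = (1/2) ^ m * sup_norm (restr E x)"
  by (simp add: tree_sum_def)

lemma tree_sum_Node:
  assumes "ts \<noteq> []" shows "tree_sum m (Node E ts) x = (\<Sum>t\<leftarrow>ts. tree_sum (Suc m) t x)"
proof -
  have "sum_list (map f (concat xs)) = (\<Sum>x\<leftarrow>xs. sum_list (map f x))"
    for f :: "nat \<times> nat set \<Rightarrow> real" and xs
    by (induction xs) auto
  then show ?thesis using assms by (simp add: tree_sum_def comp_def)
qed

lemma terminals_Node: 
  "ts \<noteq> [] \<Longrightarrow> set (terminals m (Node E ts)) = (\<Union>t\<in>set ts. set (terminals (Suc m) t))"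
  by simp

lemma admissible_tree_node_set: "admissible_tree t \<Longrightarrow> finite (node_set t) \<and> 0 \<notin> node_set t"
  by (cases t) simp

lemma sup_norm_restr_empty: "sup_norm (restr {} x) = 0"
  by (simp add: sup_norm_def restr_def)

lemma admissible_tree_empty:
  assumes "admissible_tree t" "node_set t = {}"
  shows "t = Node {} []"
proof (cases t)
  case (Node E ts)
  have "ts = []"
  proof (rule ccontr)
    assume "ts \<noteq> []"
    then have "admissible 1 (map node_set ts)" "\<Union>(set (map node_set ts)) = {}" "ts \<noteq> []"
      using assms Node by auto
    then show False by (cases ts) (auto simp: admissible_def)
  qed
  then show ?thesis using assms Node by simp
qed

lemma tree_sum_empty: "admissible_tree t \<Longrightarrow> node_set t = {} \<Longrightarrow> tree_sum m t x = 0"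
  using admissible_tree_empty[of t] by (simp add: tree_sum_leaf sup_norm_restr_empty)

lemma sup_norm_restr_attained:
  assumes "finite E" "E \<noteq> {}"
  obtains i where "i \<in> E" "sup_norm (restr E x) \<le> \<bar>x i\<bar>"
proof -
  have M: "Max ((\<lambda>i. \<bar>x i\<bar>) ` E) \<in> (\<lambda>i. \<bar>x i\<bar>) ` E" using assms by (intro Max_in) auto
  then obtain i where i: "i \<in> E" "\<bar>x i\<bar> = Max ((\<lambda>i. \<bar>x i\<bar>) ` E)" by auto
  have "\<bar>restr E x k\<bar> \<le> \<bar>x i\<bar>" for k
    using assms(1) i by (auto simp: restr_def)
  then show ?thesis using that[OF i(1)] sup_norm_leI by blast
qed

text \<open>
  In each terminal set only one coordinate of largest modulus is kept.  The shift of the levels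
  by one makes room for a common root in \<open>tree_sum_le_root_weight\<close>.
\<close>

lemma tree_sum_le_weight:
  assumes "admissible_tree t" "node_set t \<noteq> {}" "\<forall>(l, E)\<in>set (terminals m t). l \<in> A"
    and F: "finite F" "{i. x i \<noteq> 0} \<subseteq> F"
  shows "\<exists>s g. tree_weight (Suc ` A) (Suc m) s g \<and> s \<in> node_set t \<and>
    (\<forall>i. g i \<noteq> 0 \<longrightarrow> i \<in> node_set t \<and> s \<le> i) \<and> tree_sum m t x \<le> 2 * (\<Sum>i\<in>F. g i * \<bar>x i\<bar>)"
  using assms(1-3)
proof (induction t arbitrary: m)
  case (Node E ts)
  show ?case
  proof (cases "ts = []")
    case True
    obtain i where i: "i \<in> E" "sup_norm (restr E x) \<le> \<bar>x i\<bar>"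
      using sup_norm_restr_attained[of E x] Node.prems by auto
    let ?g = "\<lambda>k. if k = i then (1/2) ^ Suc m else 0 :: real"
    have "(\<Sum>k\<in>F. ?g k * \<bar>x k\<bar>) = (1/2) ^ Suc m * \<bar>x i\<bar>"
    proof (cases "i \<in> F")
      case True
      then show ?thesis using F(1) by (subst sum_eq_single[of F i]) auto
    next
      case False
      then have "x i = 0" using F(2) by blast
      then show ?thesis using False by (auto intro!: sum.neutral)
    qed
    moreover have "tree_sum m (Node E ts) x \<le> (1/2) ^ m * \<bar>x i\<bar>"
      unfolding True tree_sum_leaf by (intro mult_left_mono i(2)) simp
    ultimately have "tree_sum m (Node E ts) x \<le> 2 * (\<Sum>k\<in>F. ?g k * \<bar>x k\<bar>)"
      by (simp only: power_Suc)
    moreover have "tree_weight (Suc ` A) (Suc m) i ?g"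
      by (rule tree_weight.leaf) (use Node.prems True in auto)
    ultimately show ?thesis using i(1) by (intro exI[of _ i] exI[of _ ?g]) auto
  next
    case False
    then have a: "admissible 1 (map node_set ts)" and U: "\<Union>(set (map node_set ts)) = E"
      using Node.prems by simp_all
    let ?k = "length ts"
    define good where "good = (\<lambda>p s g. tree_weight (Suc ` A) (Suc (Suc m)) s g \<and>
        s \<in> node_set (ts ! p) \<and> (\<forall>i. g i \<noteq> 0 \<longrightarrow> i \<in> node_set (ts ! p) \<and> s \<le> i) \<and>
        tree_sum (Suc m) (ts ! p) x \<le> 2 * (\<Sum>i\<in>F. g i * \<bar>x i\<bar>))"
    have "\<exists>s g. good p s g" if p: "p < ?k" for p
      unfolding good_def
    proof (rule Node.IH)
      have t: "ts ! p \<in> set ts" using p by simp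
      then show "ts ! p \<in> set ts" .
      show "admissible_tree (ts ! p)" using Node.prems(1) t by simp
      show "node_set (ts ! p) \<noteq> {}" using a t by (auto simp: admissible_def)
      show "\<forall>(l, E)\<in>set (terminals (Suc m) (ts ! p)). l \<in> A"
        using Node.prems(3) t unfolding terminals_Node[OF False] by blast
    qed
    then obtain u h where "\<And>p. p < ?k \<Longrightarrow> good p (u p) (h p)" by metis
    then have h: "\<And>p. p < ?k \<Longrightarrow> tree_weight (Suc ` A) (Suc (Suc m)) (u p) (h p)"
      "\<And>p. p < ?k \<Longrightarrow> u p \<in> node_set (ts ! p)"
      "\<And>p i. p < ?k \<Longrightarrow> h p i \<noteq> 0 \<Longrightarrow> i \<in> node_set (ts ! p) \<and> u p \<le> i"
      "\<And>p. p < ?k \<Longrightarrow> tree_sum (Suc m) (ts ! p) x \<le> 2 * (\<Sum>i\<in>F. h p i * \<bar>x i\<bar>)"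
      unfolding good_def by blast+
    have MinE: "Min E \<in> E" "\<And>i. i \<in> E \<Longrightarrow> Min E \<le> i"
      using Node.prems by auto
    have fin: "finite (node_set t) \<and> node_set t \<noteq> {}" if "t \<in> set ts" for t
      using a that by (simp add: admissible_def)
    have less: "i < i'" if "p < r" "r < ?k" "i \<in> node_set (ts ! p)" "i' \<in> node_set (ts ! r)"
      for p r i i'
    proof -
      have "sorted_wrt set_less (map node_set ts)" using a by (simp add: admissible_def)
      then have "set_less (map node_set ts ! p) (map node_set ts ! r)"
        by (rule sorted_wrt_nth_less) (use that in auto)
      then show ?thesis using that fin by (simp add: set_less_iff)
    qed
    have sub: "node_set (ts ! p) \<subseteq> E" if "p < ?k" for p using U that by auto
    let ?g = "\<lambda>i. \<Sum>p<?k. h p i"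
    have "?k \<le> Min E"
    proof -
      obtain E' where "E' \<in> set (map node_set ts)" "Min E \<in> E'" using U MinE(1) by blast
      then show ?thesis using admissible_1_length_le[OF a] by simp
    qed
    then have "tree_weight (Suc ` A) (Suc m) (Min E) ?g"
    proof (rule tree_weight.branch[where u = u])
      show "tree_weight (Suc ` A) (Suc (Suc m)) (u p) (h p)" if "p < ?k" for p by (rule h(1)[OF that])
      show "u p \<le> i" if "p < ?k" "h p i \<noteq> 0" for p i using h(3) that by blast
      show "i < u r" if "p < r" "r < ?k" "h p i \<noteq> 0" for p r i
        by (rule less[OF that(1,2)]) (use h(2,3) that in auto)
    qed
    moreover have "i \<in> E \<and> Min E \<le> i" if "?g i \<noteq> 0" for i
    proof -
      obtain p where "p < ?k" "h p i \<noteq> 0" using sum.not_neutral_contains_not_neutral[OF \<open>?g i \<noteq> 0\<close>] by blast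
      then have "i \<in> E" using h(3) sub by blast
      then show ?thesis using MinE by blast
    qed
    moreover have "tree_sum m (Node E ts) x \<le> 2 * (\<Sum>i\<in>F. ?g i * \<bar>x i\<bar>)"
    proof -
      have "tree_sum m (Node E ts) x = (\<Sum>p<?k. tree_sum (Suc m) (ts ! p) x)"
        unfolding tree_sum_Node[OF False] by (simp add: sum_list_sum_nth atLeast0LessThan)
      also have "\<dots> \<le> (\<Sum>p<?k. 2 * (\<Sum>i\<in>F. h p i * \<bar>x i\<bar>))"
        by (rule sum_mono) (use h(4) in auto)
      also have "\<dots> = 2 * (\<Sum>i\<in>F. \<Sum>p<?k. h p i * \<bar>x i\<bar>)"
        by (subst sum.swap) (simp only: sum_distrib_left)
      finally show ?thesis by (simp only: sum_distrib_right)
    qed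
    ultimately show ?thesis using MinE by (intro exI[of _ "Min E"] exI[of _ ?g]) auto
  qed
qed

lemma tree_sum_le_root_weight:
  assumes t: "admissible_tree t" "\<forall>(l, E)\<in>set (terminals 0 t). l \<in> A"
    and F: "finite F" "{i. x i \<noteq> 0} \<subseteq> F"
  shows "\<exists>g. tree_weight (Suc ` A) 0 1 g \<and> tree_sum 0 t x \<le> 2 * (\<Sum>i\<in>F. g i * \<bar>x i\<bar>)"
proof (cases "node_set t = {}")
  case True
  have "tree_weight (Suc ` A) 0 1 (\<lambda>i. \<Sum>p<0::nat. 0)"
    by (rule tree_weight.branch[where h = "\<lambda>_ _. 0"]) auto
  then show ?thesis using tree_sum_empty[OF t(1) True, of 0 x] by auto
next
  case False
  obtain s g where g: "tree_weight (Suc ` A) (Suc 0) s g" "\<forall>i. g i \<noteq> 0 \<longrightarrow> s \<le> i"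
    "tree_sum 0 t x \<le> 2 * (\<Sum>i\<in>F. g i * \<bar>x i\<bar>)"
    using tree_sum_le_weight[OF t(1) False t(2) F] by blast
  have "tree_weight (Suc ` A) 0 1 (\<lambda>i. \<Sum>p<1::nat. g i)"
    by (rule tree_weight.branch[where u = "\<lambda>_. s"]) (use g in auto)
  then show ?thesis using g(3) by auto
qed

lemma sum_tree_sums_le:
  assumes x: "x \<in> c00" "x \<noteq> (\<lambda>_. 0)" "\<And>i. x i \<noteq> 0 \<Longrightarrow> 2 * n + 2 \<le> i"
    and t: "\<And>j. j < n \<Longrightarrow> admissible_tree (t j)"
      "\<And>j. j < n \<Longrightarrow> \<forall>(l, E)\<in>set (terminals 0 (t j)). \<exists>k. l = j + n * k"
  shows "(\<Sum>j<n. tree_sum 0 (t j) x) \<le> 32 * tsirelson_norm x"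
proof -
  define F where "F = {i. x i \<noteq> 0}"
  define A where "A = (\<lambda>j. {l. \<exists>k. l = j + n * k})"
  have F: "finite F" "F \<noteq> {}" using x by (auto simp: F_def c00_def fun_eq_iff)
  have x0: "x 0 = 0" using x by (simp add: c00_def)
  have "\<exists>g. tree_weight (Suc ` A j) 0 1 g \<and> tree_sum 0 (t j) x \<le> 2 * (\<Sum>i\<in>F. g i * \<bar>x i\<bar>)"
    if "j < n" for j
    by (rule tree_sum_le_root_weight) (use t[OF that] F in \<open>auto simp: A_def F_def\<close>)
  then obtain g where g: "\<And>j. j < n \<Longrightarrow> tree_weight (Suc ` A j) 0 1 (g j)"
    "\<And>j. j < n \<Longrightarrow> tree_sum 0 (t j) x \<le> 2 * (\<Sum>i\<in>F. g j i * \<bar>x i\<bar>)" by metis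
  have Min: "2 * n + 2 \<le> Min F" using F x(3) by (simp add: F_def)
  have "(\<Sum>j<n. tree_sum 0 (t j) x) \<le> (\<Sum>j<n. 2 * (\<Sum>i\<in>F. g j i * \<bar>x i\<bar>))"
    by (rule sum_mono) (use g(2) in auto)
  also have "\<dots> = 2 * (\<Sum>j<n. \<Sum>i\<in>F. g j i * \<bar>x i\<bar>)" by (simp only: sum_distrib_left)
  also have "\<dots> = 2 * (\<Sum>i\<in>F. (\<Sum>j<n. g j i) * \<bar>x i\<bar>)"
    by (subst sum.swap) (simp only: sum_distrib_right)
  also have "\<dots> \<le> 2 * (8 * (1/2) ^ 0 * (tsirelson_norm (restr (F \<inter> {..(Min F)\<^sup>2}) x) +
      tsirelson_norm (restr (F \<inter> {(Min F)\<^sup>2<..}) x)))"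
  proof (rule mult_left_mono, rule superposition[where n = n and A = "\<lambda>j. Suc ` A j" and s = "\<lambda>_. 1"])
    show "disjoint_family_on (\<lambda>j. Suc ` A j) {..<n}"
      unfolding disjoint_family_on_def
    proof (intro ballI impI)
      fix a b assume ab: "a \<in> {..<n}" "b \<in> {..<n}" "a \<noteq> b"
      have "l mod n = j" if "l \<in> A j" "j < n" for l j using that by (auto simp: A_def)
      then have "A a \<inter> A b = {}" using ab by blast
      then show "Suc ` A a \<inter> Suc ` A b = {}" by blast
    qed
  qed (use F Min x0 g(1) in auto)
  also have "\<dots> \<le> 2 * (8 * (1/2) ^ 0 * (tsirelson_norm x + tsirelson_norm x))"
    by (intro mult_left_mono add_mono tn_restr x(1)) auto
  finally show ?thesis by simp
qed

section \<open>Splitting a tree by residues of levels\<close>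

lemma sum_sum_list_swap:
  fixes f :: "'a \<Rightarrow> 'b \<Rightarrow> 'c::comm_monoid_add"
  shows "(\<Sum>j\<in>J. \<Sum>F\<leftarrow>Fs. f F j) = (\<Sum>F\<leftarrow>Fs. \<Sum>j\<in>J. f F j)"
  by (induction Fs) (auto simp: sum.distrib)

definition residue_tree :: "nat \<Rightarrow> nat \<Rightarrow> nat \<Rightarrow> nat set \<Rightarrow> set_tree \<Rightarrow> bool" where
  "residue_tree n j m E t \<longleftrightarrow> admissible_tree t \<and> node_set t \<subseteq> E \<and>
     (node_set t \<noteq> {} \<longrightarrow> (\<forall>(l, E)\<in>set (terminals m t). l mod n = j))"

lemma residue_tree_graft:
  assumes Es: "admissible 1 Es"
    and t: "\<And>E. E \<in> set Es \<Longrightarrow> residue_tree n j (Suc m) (E \<inter> H) (t E)"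
  obtains T where "residue_tree n j m H T" "tree_sum m T x = (\<Sum>E\<leftarrow>Es. tree_sum (Suc m) (t E) x)"
proof -
  define ts where "ts = filter (\<lambda>t. node_set t \<noteq> {}) (map t Es)"
  define T where "T = Node (\<Union>(set (map node_set ts))) ts"
  have ts: "\<exists>E\<in>set Es. node_set t' \<subseteq> E" "admissible_tree t'" "node_set t' \<subseteq> H"
    "node_set t' \<noteq> {}" "\<forall>(l, E)\<in>set (terminals (Suc m) t'). l mod n = j"
    if t': "t' \<in> set ts" for t'
  proof -
    obtain E where E: "E \<in> set Es" "t' = t E" and ne: "node_set t' \<noteq> {}"
      using t' by (auto simp: ts_def)
    then have "residue_tree n j (Suc m) (E \<inter> H) t'" using t by blast
    then show "\<exists>E\<in>set Es. node_set t' \<subseteq> E" "admissible_tree t'" "node_set t' \<subseteq> H"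
      "node_set t' \<noteq> {}" "\<forall>(l, E)\<in>set (terminals (Suc m) t'). l mod n = j"
      using E(1) ne unfolding residue_tree_def by blast+
  qed
  have E: "finite E" "E \<noteq> {}" if "E \<in> set Es" for E using Es that by (auto simp: admissible_def)
  have adm: "admissible 1 (map node_set ts)"
  proof (rule admissible_1I)
    fix E assume "E \<in> set (map node_set ts)"
    then show "finite E \<and> E \<noteq> {} \<and> 0 \<notin> E"
      using ts(2,4) admissible_tree_node_set by (metis imageE list.set_map)
  next
    have "sorted_wrt set_less Es" using Es by (simp add: admissible_def)
    then have "sorted_wrt (\<lambda>E F. set_less (node_set (t E)) (node_set (t F))) Es"
    proof (rule sorted_wrt_mono_rel[rotated])
      fix E F assume EF: "E \<in> set Es" "F \<in> set Es" "set_less E F"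
      then have lt: "\<forall>i\<in>E. \<forall>k\<in>F. i < k" using E set_less_iff[of E F] by blast
      have sub: "node_set (t E) \<subseteq> E" "node_set (t F) \<subseteq> F"
        using t EF(1,2) by (auto simp: residue_tree_def)
      have "finite (node_set (t E))" "finite (node_set (t F))"
        using sub E EF finite_subset by blast+
      then show "set_less (node_set (t E)) (node_set (t F))"
        using lt sub set_less_iff[of "node_set (t E)" "node_set (t F)"]
        by (cases "node_set (t E) = {} \<or> node_set (t F) = {}") (auto simp: set_less_def)
    qed
    then show "sorted_wrt set_less (map node_set ts)"
      unfolding ts_def by (simp add: sorted_wrt_map sorted_wrt_filter filter_map)
  next
    fix E i assume "E \<in> set (map node_set ts)" "i \<in> E"
    then obtain E' where E': "E' \<in> set Es" "i \<in> E'"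
      using ts(1) by (metis imageE list.set_map subsetD)
    have "length ts \<le> length Es"
      unfolding ts_def using length_filter_le[of _ "map t Es"] by simp
    then show "length (map node_set ts) \<le> i"
      using admissible_1_length_le[OF Es E'] by simp
  qed
  have fin: "finite (node_set t') \<and> 0 \<notin> node_set t'" if "t' \<in> set ts" for t'
    by (rule admissible_tree_node_set[OF ts(2)[OF that]])
  have "residue_tree n j m H T"
    unfolding residue_tree_def
  proof (intro conjI impI)
    show "admissible_tree T"
      unfolding T_def using adm fin ts(2) by auto
    show "node_set T \<subseteq> H"
      unfolding T_def using ts(3) by auto
    assume "node_set T \<noteq> {}"
    then have ne: "ts \<noteq> []" by (auto simp: T_def)
    show "\<forall>(l, E)\<in>set (terminals m T). l mod n = j"
      unfolding T_def terminals_Node[OF ne] using ts(5) by blast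
  qed
  moreover have "tree_sum m T x = (\<Sum>E\<leftarrow>Es. tree_sum (Suc m) (t E) x)"
  proof -
    have "tree_sum m T x = (\<Sum>t\<leftarrow>ts. tree_sum (Suc m) t x)"
      by (cases "ts = []") (simp_all add: T_def tree_sum_leaf sup_norm_restr_empty tree_sum_Node)
    also have "\<dots> = (\<Sum>t\<leftarrow>map t Es. tree_sum (Suc m) t x)"
      unfolding ts_def
      by (rule sum_list_map_filter) (use t tree_sum_empty in \<open>auto simp: residue_tree_def\<close>)
    finally show ?thesis by (simp add: comp_def)
  qed
  ultimately show ?thesis by (rule that)
qed

text \<open>
  The supremum in the definition of the norm need not be attained; the factor \<open>\<theta>\<close> makes up for
  this.
\<close>

lemma norm_iter_le_residue_trees:
  assumes n: "n \<ge> 1" and x: "x \<in> c00" and "finite H" "0 \<notin> H" "0 < \<theta>" "\<theta> < (1 :: real)"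
  shows "\<exists>t. (\<forall>j<n. residue_tree n j m H (t j)) \<and>
    \<theta> * ((1/2) ^ m * norm_iter k (restr H x)) \<le> (\<Sum>j<n. tree_sum m (t j) x)"
  using assms(3-)
proof (induction k arbitrary: H m \<theta>)
  have terminal: "\<exists>t. (\<forall>j<n. residue_tree n j m H (t j)) \<and>
    \<theta> * ((1/2) ^ m * sup_norm (restr H x)) \<le> (\<Sum>j<n. tree_sum m (t j) x)"
    if H: "finite H" "0 \<notin> H" and \<theta>: "0 < \<theta>" "\<theta> < 1" for H m \<theta>
  proof -
    define t where "t = (\<lambda>j. if j = m mod n then Node H [] else Node {} [])"
    have "(\<Sum>j<n. tree_sum m (t j) x) = tree_sum m (t (m mod n)) x"
      by (rule sum_eq_single) (use n in \<open>auto simp: t_def tree_sum_leaf sup_norm_restr_empty\<close>)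
    then have e: "(\<Sum>j<n. tree_sum m (t j) x) = (1/2) ^ m * sup_norm (restr H x)"
      by (simp add: t_def tree_sum_leaf)
    have "0 \<le> (1/2) ^ m * sup_norm (restr H x)"
      using sup_norm_nonneg[OF c00_restr[OF x]] by simp
    then have "\<theta> * ((1/2) ^ m * sup_norm (restr H x)) \<le> (\<Sum>j<n. tree_sum m (t j) x)"
      unfolding e using \<theta> by (intro mult_left_le_one_le) auto
    moreover have "\<forall>j<n. residue_tree n j m H (t j)"
      using H by (auto simp: residue_tree_def t_def)
    ultimately show ?thesis by blast
  qed
  case 0
  then show ?case using terminal by simp
  case (Suc k)
  define v where "v = Sup (half_sums (norm_iter k) (restr H x))"
  show ?case
  proof (cases "v \<le> sup_norm (restr H x)")
    case True
    then have "norm_iter (Suc k) (restr H x) = sup_norm (restr H x)" by (simp add: v_def)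
    then show ?thesis using terminal[OF Suc.prems] by simp
  next
    case False
    define \<eta> where "\<eta> = sqrt \<theta>"
    have \<eta>: "0 < \<eta>" "\<eta> < 1" "\<eta> * \<eta> = \<theta>" using Suc.prems by (auto simp: \<eta>_def real_sqrt_lt_1_iff)
    have v: "norm_iter (Suc k) (restr H x) = v" using False by (simp add: v_def)
    have "0 < v" using False sup_norm_nonneg[OF c00_restr[OF x, of H]] by simp
    then have "\<eta> * v < v" using \<eta> by simp
    then obtain y where y: "y \<in> half_sums (norm_iter k) (restr H x)" "\<eta> * v < y"
      unfolding v_def using less_cSupD[OF half_sums_nonempty] by blast
    then obtain Es where Es: "admissible 1 Es"
      "y = 1/2 * (\<Sum>E\<leftarrow>Es. norm_iter k (restr (E \<inter> H) x))"
      by (auto simp: half_sums_def restr_restr)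
    have "\<exists>t. (\<forall>j<n. residue_tree n j (Suc m) (E \<inter> H) (t j)) \<and>
        \<eta> * ((1/2) ^ Suc m * norm_iter k (restr (E \<inter> H) x)) \<le> (\<Sum>j<n. tree_sum (Suc m) (t j) x)"
      if "E \<in> set Es" for E
      by (rule Suc.IH[OF _ _ \<eta>(1,2)]) (use Suc.prems(1,2) in auto)
    then obtain t where t: "\<And>E j. E \<in> set Es \<Longrightarrow> j < n \<Longrightarrow> residue_tree n j (Suc m) (E \<inter> H) (t E j)"
      "\<And>E. E \<in> set Es \<Longrightarrow> \<eta> * ((1/2) ^ Suc m * norm_iter k (restr (E \<inter> H) x))
        \<le> (\<Sum>j<n. tree_sum (Suc m) (t E j) x)" by metis
    have "\<exists>T. residue_tree n j m H T \<and> tree_sum m T x = (\<Sum>E\<leftarrow>Es. tree_sum (Suc m) (t E j) x)"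
      if "j < n" for j
      by (rule residue_tree_graft[OF Es(1), of n j m H "\<lambda>E. t E j" x]) (use t(1) that in blast)+
    then obtain T where T: "\<And>j. j < n \<Longrightarrow> residue_tree n j m H (T j)"
      "\<And>j. j < n \<Longrightarrow> tree_sum m (T j) x = (\<Sum>E\<leftarrow>Es. tree_sum (Suc m) (t E j) x)" by metis
    have "\<theta> * ((1/2) ^ m * v) = \<eta> * (1/2) ^ m * (\<eta> * v)" unfolding \<eta>(3)[symmetric] by (simp only: mult_ac)
    also have "\<dots> \<le> \<eta> * (1/2) ^ m * y" using y \<eta> by (intro mult_left_mono) auto
    also have "\<dots> = (\<Sum>E\<leftarrow>Es. \<eta> * (1/2) ^ Suc m * norm_iter k (restr (E \<inter> H) x))"
      unfolding Es(2) sum_list_const_mult by simp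
    also have "\<dots> = (\<Sum>E\<leftarrow>Es. \<eta> * ((1/2) ^ Suc m * norm_iter k (restr (E \<inter> H) x)))"
      by (simp only: mult.assoc)
    also have "\<dots> \<le> (\<Sum>E\<leftarrow>Es. \<Sum>j<n. tree_sum (Suc m) (t E j) x)"
      by (rule sum_list_mono[OF t(2)])
    also have "\<dots> = (\<Sum>j<n. tree_sum m (T j) x)"
      unfolding sum_sum_list_swap[symmetric] using T(2) by simp
    finally have "\<theta> * ((1/2) ^ m * v) \<le> (\<Sum>j<n. tree_sum m (T j) x)" .
    then show ?thesis unfolding v by (intro exI[of _ T] conjI allI impI T(1))
  qed
qed

lemma tree_norm_eq:
  "tree_norm j n z = Sup {tree_sum 0 t (coord z) | t.
     admissible_tree t \<and> (\<forall>(l, E)\<in>set (terminals 0 t). \<exists>k. l = j + n * k)}"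
  by (simp add: tree_norm_def tree_sum_def)

lemma tree_sum_le_tree_norm:
  assumes "admissible_tree t" "\<forall>(l, E)\<in>set (terminals 0 t). \<exists>k. l = j + n * k"
  shows "tree_sum 0 t (coord z) \<le> tree_norm j n z"
  unfolding tree_norm_eq
  by (rule cSup_upper, use assms in blast)
    (auto intro!: bdd_aboveI[of _ "norm z"] tree_sum_le_norm simp: tree_sum_def)

lemma chain_tree:
  defines "chain \<equiv> \<lambda>l. ((\<lambda>t. Node {1} [t]) ^^ l) (Node {1} [])"
  shows "admissible_tree (chain l) \<and> node_set (chain l) = {1} \<and> terminals m (chain l) = [(m + l, {1})]"
  unfolding chain_def by (induction l arbitrary: m) (auto simp: admissible_single)

lemma tree_sums_nonempty:
  "{tree_sum 0 t (coord z) | t. admissible_tree t \<and>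
     (\<forall>(l, E)\<in>set (terminals 0 t). \<exists>k. l = j + n * k)} \<noteq> {}"
proof -
  obtain t where "admissible_tree t" "terminals 0 t = [(j, {1})]"
    using chain_tree[of j 0] by auto
  then show ?thesis by force
qed

lemma tree_sum_nonneg: "admissible_tree t \<Longrightarrow> 0 \<le> tree_sum m t (coord z)"
proof (induction t arbitrary: m)
  case (Node E ts)
  show ?case
  proof (cases "ts = []")
    case True
    then show ?thesis using Node.prems sup_norm_nonneg[OF restr_coord_c00] by (simp add: tree_sum_leaf)
  next
    case False
    then show ?thesis
      unfolding tree_sum_Node[OF False] using Node by (intro sum_list_nonneg) auto
  qed
qed

lemma tree_norm_bounds: "0 \<le> tree_norm j n z" "tree_norm j n z \<le> norm z"
proof -
  obtain t where "admissible_tree t" "\<forall>(l, E)\<in>set (terminals 0 t). \<exists>k. l = j + n * k"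
    using tree_sums_nonempty[of z j n] by blast
  then show "0 \<le> tree_norm j n z"
    using tree_sum_nonneg tree_sum_le_tree_norm order_trans by blast
  show "tree_norm j n z \<le> norm z"
    unfolding tree_norm_eq
    by (rule cSup_least[OF tree_sums_nonempty]) (auto simp: tree_sum_def intro: tree_sum_le_norm)
qed

lemma less_tree_normD:
  assumes "c < tree_norm j n z"
  obtains t where "admissible_tree t" "\<forall>(l, E)\<in>set (terminals 0 t). \<exists>k. l = j + n * k"
    "c < tree_sum 0 t (coord z)"
proof -
  from less_cSupD[OF tree_sums_nonempty assms[unfolded tree_norm_eq]] show ?thesis
    using that by auto
qed

lemma norm_eq_tn: "coord z \<in> c00 \<Longrightarrow> norm z = tsirelson_norm (coord z)"
  using norm_Tsirelson_c00[of "coord z"] by (simp add: coord_inverse)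

lemma norm_le_sum_tree_norms:
  assumes n: "n \<ge> 1" and z: "coord z \<in> c00"
  shows "norm z \<le> (\<Sum>j<n. tree_norm j n z)"
proof -
  define H where "H = {i. coord z i \<noteq> 0}"
  have H: "finite H" "0 \<notin> H" "restr H (coord z) = coord z"
    using z by (auto simp: H_def c00_def intro: restr_supp)
  have "norm_iter k (coord z) \<le> (\<Sum>j<n. tree_norm j n z)" for k
  proof (rule field_le_mult_one_interval)
    fix \<theta> :: real assume \<theta>: "0 < \<theta>" "\<theta> < 1"
    obtain t where t: "\<forall>j<n. residue_tree n j 0 H (t j)"
      "\<theta> * ((1/2) ^ 0 * norm_iter k (restr H (coord z))) \<le> (\<Sum>j<n. tree_sum 0 (t j) (coord z))"
      using norm_iter_le_residue_trees[OF n z H(1,2) \<theta>, of 0 k] by blast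
    have "tree_sum 0 (t j) (coord z) \<le> tree_norm j n z" if "j < n" for j
    proof (cases "node_set (t j) = {}")
      case True
      then have "tree_sum 0 (t j) (coord z) = 0"
        using t(1) that by (intro tree_sum_empty) (auto simp: residue_tree_def)
      then show ?thesis using tree_norm_bounds(1) by simp
    next
      case False
      have "\<exists>k. l = j + n * k" if "l mod n = j" for l
        using that by (intro exI[of _ "l div n"]) (metis add.commute div_mult_mod_eq mult.commute)
      then show ?thesis
        using t(1) that False by (intro tree_sum_le_tree_norm) (fastforce simp: residue_tree_def)+
    qed
    then have "(\<Sum>j<n. tree_sum 0 (t j) (coord z)) \<le> (\<Sum>j<n. tree_norm j n z)"
      by (intro sum_mono) auto
    then show "\<theta> * norm_iter k (coord z) \<le> (\<Sum>j<n. tree_norm j n z)"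
      using t(2) H(3) by simp
  qed
  then show ?thesis
    unfolding norm_eq_tn[OF z] tsirelson_norm_eq_lim by (intro norm_lim_leI[OF z])
qed

lemma unit_sphere_tail:
  assumes "block_subspace_of Z Y"
  obtains z where "z \<in> unit_sphere Z" "coord z \<in> c00" "\<And>i. coord z i \<noteq> 0 \<Longrightarrow> N \<le> i"
proof -
  obtain y w where y: "block_basis unit_basis y" and w: "block_basis y w" and Z: "Z = closed_span w"
    using assms unfolding block_subspace_of_def by blast
  define S where "S = {v. coord v \<in> c00 \<and> (\<forall>i. coord v i \<noteq> 0 \<longrightarrow> N \<le> i)}"
  have sub: "subspace S"
    unfolding subspace_def
  proof (intro conjI allI ballI)
    show "0 \<in> S" by (simp add: S_def coord_simps)
    show "u + v \<in> S" if "u \<in> S" "v \<in> S" for u v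
    proof -
      have "N \<le> i" if "coord u i + coord v i \<noteq> 0" for i
        using that \<open>u \<in> S\<close> \<open>v \<in> S\<close> by (cases "coord u i = 0") (auto simp: S_def)
      then show ?thesis using that c00_add by (simp add: S_def coord_plus)
    qed
    show "r *\<^sub>R v \<in> S" if "v \<in> S" for r v
      using that c00_scale[of "coord v" r] by (auto simp: S_def coord_simps)
  qed
  have block: "v k \<in> S" if v: "block_basis u v" and u: "\<And>i. N \<le> i \<Longrightarrow> u i \<in> S" and k: "N \<le> k" for u v k
  proof -
    obtain p a where p: "strict_mono p" "\<And>i. v i = (\<Sum>k\<in>{p i..<p (Suc i)}. a k *\<^sub>R u k)"
      using v unfolding block_basis_def by blast
    show ?thesis
      unfolding p(2)
    proof (intro subspace_sum[OF sub] subspace_scale[OF sub] u)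
      fix l assume "l \<in> {p k..<p (Suc k)}"
      then show "N \<le> l" using strict_mono_imp_increasing[OF p(1), of k] k by simp
    qed
  qed
  have "unit_basis i \<in> S" if "N \<le> i" for i
    using that by (auto simp: S_def coord_unit_basis c00_def)
  then have yS: "y i \<in> S" if "N \<le> i" for i by (rule block[OF y _ that])
  have wS: "w N \<in> S" by (rule block[OF w yS order_refl])
  define z where "z = inverse (norm (w N)) *\<^sub>R w N"
  have "z \<in> S" unfolding z_def by (rule subspace_scale[OF sub wS])
  moreover have "z \<in> unit_sphere Z"
  proof -
    have "w N \<noteq> 0" using w by (auto simp: block_basis_def)
    then have "norm z = 1" by (simp add: z_def)
    moreover have "z \<in> span (range w)" unfolding z_def by (intro span_scale span_base) simp
    ultimately show ?thesis using closure_subset unfolding unit_sphere_def Z closed_span_def by blast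
  qed
  ultimately show ?thesis using that by (auto simp: S_def)
qed

lemma stable_at_bounds:
  assumes st: "stable_at K n d Z" and j: "j < n" and z: "z \<in> unit_sphere Z"
  shows "d \<le> tree_norm j n z" "tree_norm j n z \<le> K * d"
proof -
  have bds: "0 \<le> tree_norm i n v" "tree_norm i n v \<le> 1" if "v \<in> unit_sphere Z" for i v
    using tree_norm_bounds[of i n v] that by (auto simp: unit_sphere_def)
  have "d \<le> (INF v\<in>unit_sphere Z. tree_norm j n v)"
    using st j unfolding stable_at_def by (auto intro: cINF_lower)
  also have "\<dots> \<le> tree_norm j n z"
    by (rule cINF_lower[OF _ z]) (use bds in \<open>auto intro: bdd_belowI2[where m = 0]\<close>)
  finally show "d \<le> tree_norm j n z" .
  have "tree_norm j n z \<le> (SUP v\<in>unit_sphere Z. tree_norm j n v)"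
    by (rule cSUP_upper[OF z]) (use bds in \<open>auto intro: bdd_aboveI2[where M = 1]\<close>)
  also have "\<dots> \<le> (SUP i\<in>{0..<n}. SUP v\<in>unit_sphere Z. tree_norm i n v)"
    by (rule cSUP_upper) (use j in auto)
  also have "\<dots> \<le> K * d" using st unfolding stable_at_def by blast
  finally show "tree_norm j n z \<le> K * d" .
qed

theorem theorem3p5:
  fixes K :: real
  assumes "K > 1"
    and "stabilization_constant K"
  shows "\<exists>L::real. \<forall>(n::nat) (d::real) Y Z.
    n \<ge> 1 \<longrightarrow> d > 0 \<longrightarrow> block_subspace Y \<longrightarrow> block_subspace_of Z Y \<longrightarrow> stable_at K n d Z \<longrightarrow>
      inverse (K * real n) \<le> d \<and> d \<le> L * inverse (real n)"
proof (intro exI[of _ 32] allI impI)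
  fix n :: nat and d :: real and Y Z
  assume n: "n \<ge> 1" and d: "d > 0" and Z: "block_subspace_of Z Y" and st: "stable_at K n d Z"
  obtain z where z: "z \<in> unit_sphere Z" "coord z \<in> c00" "\<And>i. coord z i \<noteq> 0 \<Longrightarrow> 2 * n + 2 \<le> i"
    using unit_sphere_tail[OF Z] by blast
  have norm1: "norm z = 1" using z(1) by (simp add: unit_sphere_def)
  have "norm z \<le> (\<Sum>j<n. tree_norm j n z)" by (rule norm_le_sum_tree_norms[OF n z(2)])
  also have "\<dots> \<le> (\<Sum>j<n. K * d)"
    by (rule sum_mono) (use stable_at_bounds(2)[OF st _ z(1)] in auto)
  finally have "1 \<le> K * real n * d" by (simp add: norm1 mult_ac)
  then have lower: "inverse (K * real n) \<le> d"
    using n \<open>K > 1\<close> by (simp add: inverse_eq_divide divide_le_eq mult_ac)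
  have "d \<le> 32 * inverse (real n)"
  proof (rule ccontr)
    assume "\<not> d \<le> 32 * inverse (real n)"
    then have gt: "32 * inverse (real n) < tree_norm j n z" if "j < n" for j
      using stable_at_bounds(1)[OF st that z(1)] by linarith
    have "\<exists>t. admissible_tree t \<and> (\<forall>(l, E)\<in>set (terminals 0 t). \<exists>k. l = j + n * k) \<and>
        32 * inverse (real n) < tree_sum 0 t (coord z)" if "j < n" for j
      using less_tree_normD[OF gt[OF that]] by metis
    then obtain t where t: "\<And>j. j < n \<Longrightarrow> admissible_tree (t j)"
      "\<And>j. j < n \<Longrightarrow> \<forall>(l, E)\<in>set (terminals 0 (t j)). \<exists>k. l = j + n * k"
      "\<And>j. j < n \<Longrightarrow> 32 * inverse (real n) < tree_sum 0 (t j) (coord z)" by metis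
    have "coord z \<noteq> (\<lambda>_. 0)" using norm_eq_tn[OF z(2)] norm1 tn_zero by auto
    then have "(\<Sum>j<n. tree_sum 0 (t j) (coord z)) \<le> 32 * tsirelson_norm (coord z)"
      by (rule sum_tree_sums_le[OF z(2)]) (use z(3) t(1,2) in auto)
    also have "\<dots> = 32" using norm_eq_tn[OF z(2)] norm1 by simp
    also have "\<dots> = (\<Sum>j<n. 32 * inverse (real n))" using n by simp
    also have "\<dots> < (\<Sum>j<n. tree_sum 0 (t j) (coord z))"
      by (rule sum_strict_mono) (use t(3) n in \<open>auto simp: lessThan_empty_iff\<close>)
    finally show False by simp
  qed
  with lower show "inverse (K * real n) \<le> d \<and> d \<le> 32 * inverse (real n)" ..
qed

end
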